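(* Let $\Delta,\Gamma$ be visibility functions and $P,Q$ closed processes with $\Delta\vdash P$ and $\Delta\vdash Q$. If $P\approx^{\Delta}_{\Gamma}Q$ (typed bisimilarity under $\Gamma$), then $P$ and $Q$ are barbed equivalent at $\Gamma$.
   Context: Calculus. Names are partitioned into higher-order names $a,b,c,\dots$ (set $N_{ho}$), first-order names $h,k$, success names $\omega$; first-order values $v$, variables $x$, expressions $e,f$ (closed ones evaluate: $e\Downarrow v$). Processes: $P::= a(x,b).P \mid h(x).P \mid \overline{a}\langle e\rangle(b).P \mid \overline{h}\langle e\rangle.P \mid \omega.P \mid\ !\alpha.P \mid P|Q \mid \nu a\,P \mid \nu h\,P \mid 0 \mid P+Q \mid \mathtt{if}\ e=f\ \mathtt{then}\ P\ \mathtt{else}\ Q$ ($\alpha$ an input prefix; $\overline a\langle e\rangle(b)$ outputs $e$ with a fresh bound name $b$; closed processes up to $\alpha$-conversion). Actions $\mu::=\tau\mid a\langle v\rangle(b)\mid \overline a\langle v\rangle(b)\mid h\langle v\rangle\mid \overline h\langle v\rangle\mid\omega$ with the standard transitions: $a(x,b).P\xrightarrow{a\langle v\rangle(b)}P[v/x]$; $\overline a\langle e\rangle(b).P\xrightarrow{\overline a\langle v\rangle(b)}P$ if $e\Downarrow v$; $h(x).P\xrightarrow{h\langle v\rangle}P[v/x]$; $\overline h\langle e\rangle.P\xrightarrow{\overline h\langle v\rangle}P$ if $e\Downarrow v$; $\omega.P\xrightarrow{\omega}0$; $!\alpha.P$ behaves as $\alpha.P|!\alpha.P$; restriction $\nu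 n$ lets through actions not mentioning $n$; sum chooses a summand; $P|Q\xrightarrow{\tau}\nu b(P'|Q')$ if $P\xrightarrow{a\langle v\rangle(b)}P'$, $Q\xrightarrow{\overline a\langle v\rangle(b)}Q'$; $P|Q\xrightarrow{\tau}P'|Q'$ if $P\xrightarrow{h\langle v\rangle}P'$, $Q\xrightarrow{\overline h\langle v\rangle}Q'$; interleaving when bound names are not free in the other component; conditional follows the selected branch. $P\longrightarrow P'$ means $P\xrightarrow{\tau}P'$, $\Longrightarrow$ its reflexive-transitive closure; $P\Downarrow_\omega$ iff $P\Longrightarrow P'\xrightarrow{\omega}$. A visibility function is a finite partial transitive function $\Delta:N_{ho}\cup\{\mathsf{cur}\}\to\mathcal P_{fin}(N_{ho})$ (transitive: $o,a\in\mathrm{dom}\Delta$, $a\in\Delta(o)$ imply $\Delta(a)\subseteq\Delta(o)$). $\Delta,p\mapsto V$ extends; $\Delta\setminus p$ erases $p$ from domain and values; $\Delta_1\cup\Delta_2$: domain union, pointwise union; $(\Delta_1,\Delta_2)\in\mathrm{split}(\Delta)$ iff $\Delta_1\cup\Delta_2=\Delta$ and $\mathsf{cur}\notin\mathrm{dom}\Delta_1\cap\mathrm{dom}\Delta_2$; compatible iff $\mathsf{cur}\notin\mathrm{dom}\Delta\cap\mathrm{dom}\Gamma$. Typing $\Delta\vdash P$: least relation with $\Delta\vdash\overline a\langle e\rangle(b).P$ if $a\in\Delta(\mathsf{cur})$ and $(\Delta\setminus\mathsf{cur}),b\mapsto\Delta(\mathsf{cur})\cup\{b\}\vdash P$; $\Delta\vdash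 a(x,b).P$ if $\mathsf{cur}\notin\mathrm{dom}\Delta$, $a\in\mathrm{dom}\Delta$, $\Delta,\mathsf{cur}\mapsto\Delta(a)\cup\{b\}\vdash P$; $\Delta\vdash\overline h\langle e\rangle.P$ if $\Delta\vdash P$, $\mathsf{cur}\notin\mathrm{dom}\Delta$; $\Delta\vdash h(x).P$ if $\Delta\vdash P$, $\mathsf{cur}\in\mathrm{dom}\Delta$; $\Delta\vdash!\alpha.P$ if $\Delta\vdash\alpha.P$, $\mathsf{cur}\notin\mathrm{dom}\Delta$; $\Delta\vdash\omega.P$; $\Delta\setminus a\vdash\nu aP$ if $\Delta\vdash P$; $\Delta\vdash\nu hP$ if $\Delta\vdash P$; $\Delta\vdash0$ if $\mathsf{cur}\notin\mathrm{dom}\Delta$; sums/conditionals if both branches typed under $\Delta$; $\Delta\vdash P_1|P_2$ if $\Delta_i\vdash P_i$, $(\Delta_1,\Delta_2)\in\mathrm{split}(\Delta)$. Barbed bisimilarity is the largest symmetric relation $\dot\approx$ on processes such that $P\dot\approx Q$ implies: whenever $P\longrightarrow P'$ there is $Q'$ with $Q\Longrightarrow Q'$ and $P'\dot\approx Q'$; and for every $\omega$, $P\Downarrow_\omega$ implies $Q\Downarrow_\omega$. For compatible $\Delta,\Gamma$ and $\Delta$-processes $P,Q$, $P,Q$ are barbed equivalent at $\Gamma$ iff for all closed $R$ with $\Gamma\vdash R$, $P|R\,\dot\approx\,Q|R$. Type-allowed transitions (observer visibility $\Gamma$): if $P\xrightarrow{\overline a\langle v\rangle(b)}P'$, $a\in\mathrm{dom}\Gamma$,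 $\mathsf{cur}\notin\mathrm{dom}\Gamma$: $\Gamma:P\xrightarrow{\overline a\langle v\rangle(b)}(\Gamma,\mathsf{cur}\mapsto\Gamma(a)\cup\{b\}):P'$; if $P\xrightarrow{a\langle v\rangle(b)}P'$, $a\in\Gamma(\mathsf{cur})$: $\Gamma:P\xrightarrow{a\langle v\rangle(b)}((\Gamma\setminus\mathsf{cur}),b\mapsto\Gamma(\mathsf{cur})\cup\{b\}):P'$; $\overline h\langle v\rangle$ allowed (unchanged) if $\mathsf{cur}\in\mathrm{dom}\Gamma$; $h\langle v\rangle$ and $\tau$ allowed (unchanged) if $\mathsf{cur}\notin\mathrm{dom}\Gamma$. $\Gamma:P\xRightarrow{\hat\mu}\Gamma':P'$ means zero or more typed $\tau$-steps (with $\Gamma'=\Gamma$) if $\mu=\tau$, and otherwise typed $\tau$-steps, a $\mu$-step, typed $\tau$-steps. A typed relation is a set of triples $(\Gamma,P,Q)$; it is a typed bisimulation if for each $(\Gamma,P,Q)$ in it, whenever $\Gamma:P\xrightarrow{\mu}\Gamma':P'$ there is $Q'$ with $\Gamma:Q\xRightarrow{\hat\mu}\Gamma':Q'$ and $(\Gamma',P',Q')$ in the relation, and symmetrically for moves of $Q$. Typed bisimilarity $\approx$ is the largest typed bisimulation; for $\Delta$-processes, $P\approx^\Delta_\Gamma Q$ iff $(\Gamma,P,Q)\in\approx$ and $\Delta,\Gamma$ are compatible.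
   Formalization: Success actions ω are also taken as type-allowed transitions (under every Γ, leaving Γ unchanged); without this ω.0 and 0 would be typed bisimilar but not barbed equivalent. For processes without success names this changes nothing. *)

theory Defs
  imports Main
begin

section \<open>Processes\<close>

text \<open>
  The classes of higher-order names, first-order names, success names and variables are kept
  apart by their argument positions; each of them is countably infinite.
\<close>

type_synonym hname = nat
type_synonym fname = nat
type_synonym sname = nat
type_synonym var = nat

text \<open>
  The language of first-order expressions is a parameter: values have type \<open>'v\<close>, operators have
  type \<open>'f\<close>, and operators are interpreted by a function \<open>I\<close>.  The type \<open>'x\<close> is that of variables.
\<close>

datatype (dead 'f, dead 'v, vars: 'x) expr =
    Var 'x
  | Val 'v
  | Op 'f "('f, 'v, 'x) expr list"
  for map: map_vars

inductive eval :: "('f \<Rightarrow> 'v list \<Rightarrow> 'v) \<Rightarrow> ('f, 'v, 'x) expr \<Rightarrow> 'v \<Rightarrow> bool"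
  for I :: "'f \<Rightarrow> 'v list \<Rightarrow> 'v" where
  eval_Val: "eval I (Val v) v"
| eval_Op: "list_all2 (eval I) es vs \<Longrightarrow> eval I (Op f es) (I f vs)"

primrec subst_expr :: "'x \<Rightarrow> 'v \<Rightarrow> ('f, 'v, 'x) expr \<Rightarrow> ('f, 'v, 'x) expr" where
  "subst_expr x v (Var y) = (if y = x then Val v else Var y)"
| "subst_expr x v (Val w) = Val w"
| "subst_expr x v (Op f es) = Op f (map (subst_expr x v) es)"

text \<open>
  Processes are taken up to alpha-conversion.  Raw terms are locally nameless: a bound name or
  variable is a de Bruijn index (with a separate numbering for each of the three classes that can
  be bound), a free one is an atom.  A process is a raw term without dangling indices.  The
  constructors with named binders abstract the bound atom, so that alpha-equivalent processes are
  equal.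
\<close>

datatype ref = Free nat | Bound nat

datatype ('f, 'v) raw =
    RHIn ref "('f, 'v) raw"                         (* binds a higher-order name and a variable *)
  | RFIn ref "('f, 'v) raw"                         (* binds a variable *)
  | RHOut ref "('f, 'v, ref) expr" "('f, 'v) raw"   (* binds a higher-order name *)
  | RFOut ref "('f, 'v, ref) expr" "('f, 'v) raw"
  | RSucc sname "('f, 'v) raw"
  | RHBang ref "('f, 'v) raw"                       (* binds as RHIn *)
  | RFBang ref "('f, 'v) raw"                       (* binds as RFIn *)
  | RPar "('f, 'v) raw" "('f, 'v) raw"
  | RHNu "('f, 'v) raw"                             (* binds a higher-order name *)
  | RFNu "('f, 'v) raw"                             (* binds a first-order name *)
  | RNil
  | RSum "('f, 'v) raw" "('f, 'v) raw"
  | RIf "('f, 'v, ref) expr" "('f, 'v, ref) expr" "('f, 'v) raw" "('f, 'v) raw"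

text \<open>
  \<open>lc i j k r\<close>: the dangling indices of \<open>r\<close> for higher-order names, first-order names and
  variables are below \<open>i\<close>, \<open>j\<close> and \<open>k\<close>, respectively.
\<close>

primrec lc_ref :: "nat \<Rightarrow> ref \<Rightarrow> bool" where
  "lc_ref i (Free n) = True"
| "lc_ref i (Bound m) = (m < i)"

definition lc_expr :: "nat \<Rightarrow> ('f, 'v, ref) expr \<Rightarrow> bool" where
  "lc_expr k e = (\<forall>m \<in> vars e. lc_ref k m)"

primrec lc :: "nat \<Rightarrow> nat \<Rightarrow> nat \<Rightarrow> ('f, 'v) raw \<Rightarrow> bool" where
  "lc i j k (RHIn a r) = (lc_ref i a \<and> lc (Suc i) j (Suc k) r)"
| "lc i j k (RFIn h r) = (lc_ref j h \<and> lc i j (Suc k) r)"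
| "lc i j k (RHOut a e r) = (lc_ref i a \<and> lc_expr k e \<and> lc (Suc i) j k r)"
| "lc i j k (RFOut h e r) = (lc_ref j h \<and> lc_expr k e \<and> lc i j k r)"
| "lc i j k (RSucc w r) = lc i j k r"
| "lc i j k (RHBang a r) = (lc_ref i a \<and> lc (Suc i) j (Suc k) r)"
| "lc i j k (RFBang h r) = (lc_ref j h \<and> lc i j (Suc k) r)"
| "lc i j k (RPar r s) = (lc i j k r \<and> lc i j k s)"
| "lc i j k (RHNu r) = lc (Suc i) j k r"
| "lc i j k (RFNu r) = lc i (Suc j) k r"
| "lc i j k RNil = True"
| "lc i j k (RSum r s) = (lc i j k r \<and> lc i j k s)"
| "lc i j k (RIf e f r s) = (lc_expr k e \<and> lc_expr k f \<and> lc i j k r \<and> lc i j k s)"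

text \<open>
  The traversal applies \<open>H\<close>, \<open>F\<close>, \<open>E\<close> to the higher-order names, first-order names and expressions
  of a raw term; each is given the number of binders of its class passed so far.
\<close>

primrec trav :: "(nat \<Rightarrow> ref \<Rightarrow> ref) \<Rightarrow> (nat \<Rightarrow> ref \<Rightarrow> ref) \<Rightarrow>
    (nat \<Rightarrow> ('f, 'v, ref) expr \<Rightarrow> ('f, 'v, ref) expr) \<Rightarrow>
    nat \<Rightarrow> nat \<Rightarrow> nat \<Rightarrow> ('f, 'v) raw \<Rightarrow> ('f, 'v) raw" where
  "trav H F E i j k (RHIn a r) = RHIn (H i a) (trav H F E (Suc i) j (Suc k) r)"
| "trav H F E i j k (RFIn h r) = RFIn (F j h) (trav H F E i j (Suc k) r)"
| "trav H F E i j k (RHOut a e r) = RHOut (H i a) (E k e) (trav H F E (Suc i) j k r)"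
| "trav H F E i j k (RFOut h e r) = RFOut (F j h) (E k e) (trav H F E i j k r)"
| "trav H F E i j k (RSucc w r) = RSucc w (trav H F E i j k r)"
| "trav H F E i j k (RHBang a r) = RHBang (H i a) (trav H F E (Suc i) j (Suc k) r)"
| "trav H F E i j k (RFBang h r) = RFBang (F j h) (trav H F E i j (Suc k) r)"
| "trav H F E i j k (RPar r s) = RPar (trav H F E i j k r) (trav H F E i j k s)"
| "trav H F E i j k (RHNu r) = RHNu (trav H F E (Suc i) j k r)"
| "trav H F E i j k (RFNu r) = RFNu (trav H F E i (Suc j) k r)"
| "trav H F E i j k RNil = RNil"
| "trav H F E i j k (RSum r s) = RSum (trav H F E i j k r) (trav H F E i j k s)"
| "trav H F E i j k (RIf e f r s) =
     RIf (E k e) (E k f) (trav H F E i j k r) (trav H F E i j k s)"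

definition abs_ref :: "nat \<Rightarrow> nat \<Rightarrow> ref \<Rightarrow> ref" where
  "abs_ref n i m = (if m = Free n then Bound i else m)"

abbreviation keep :: "nat \<Rightarrow> 'b \<Rightarrow> 'b" where
  "keep \<equiv> \<lambda>_ m. m"

definition abs_h :: "hname \<Rightarrow> ('f, 'v) raw \<Rightarrow> ('f, 'v) raw" where
  "abs_h b = trav (abs_ref b) keep keep 0 0 0"

definition abs_f :: "fname \<Rightarrow> ('f, 'v) raw \<Rightarrow> ('f, 'v) raw" where
  "abs_f h = trav keep (abs_ref h) keep 0 0 0"

definition abs_v :: "var \<Rightarrow> ('f, 'v) raw \<Rightarrow> ('f, 'v) raw" where
  "abs_v x = trav keep keep (\<lambda>k. map_vars (abs_ref x k)) 0 0 0"

definition abs_hv :: "hname \<Rightarrow> var \<Rightarrow> ('f, 'v) raw \<Rightarrow> ('f, 'v) raw" where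
  "abs_hv b x = trav (abs_ref b) keep (\<lambda>k. map_vars (abs_ref x k)) 0 0 0"

definition subst_raw :: "('f, 'v) raw \<Rightarrow> var \<Rightarrow> 'v \<Rightarrow> ('f, 'v) raw" where
  "subst_raw r x v = trav keep keep (\<lambda>_. subst_expr (Free x) v) 0 0 0 r"

primrec fn_raw :: "('f, 'v) raw \<Rightarrow> hname set" where
  "fn_raw (RHIn a r) = {n. a = Free n} \<union> fn_raw r"
| "fn_raw (RFIn h r) = fn_raw r"
| "fn_raw (RHOut a e r) = {n. a = Free n} \<union> fn_raw r"
| "fn_raw (RFOut h e r) = fn_raw r"
| "fn_raw (RSucc w r) = fn_raw r"
| "fn_raw (RHBang a r) = {n. a = Free n} \<union> fn_raw r"
| "fn_raw (RFBang h r) = fn_raw r"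
| "fn_raw (RPar r s) = fn_raw r \<union> fn_raw s"
| "fn_raw (RHNu r) = fn_raw r"
| "fn_raw (RFNu r) = fn_raw r"
| "fn_raw RNil = {}"
| "fn_raw (RSum r s) = fn_raw r \<union> fn_raw s"
| "fn_raw (RIf e f r s) = fn_raw r \<union> fn_raw s"

definition fv_expr :: "('f, 'v, ref) expr \<Rightarrow> var set" where
  "fv_expr e = {x. Free x \<in> vars e}"

primrec fv_raw :: "('f, 'v) raw \<Rightarrow> var set" where
  "fv_raw (RHIn a r) = fv_raw r"
| "fv_raw (RFIn h r) = fv_raw r"
| "fv_raw (RHOut a e r) = fv_expr e \<union> fv_raw r"
| "fv_raw (RFOut h e r) = fv_expr e \<union> fv_raw r"
| "fv_raw (RSucc w r) = fv_raw r"
| "fv_raw (RHBang a r) = fv_raw r"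
| "fv_raw (RFBang h r) = fv_raw r"
| "fv_raw (RPar r s) = fv_raw r \<union> fv_raw s"
| "fv_raw (RHNu r) = fv_raw r"
| "fv_raw (RFNu r) = fv_raw r"
| "fv_raw RNil = {}"
| "fv_raw (RSum r s) = fv_raw r \<union> fv_raw s"
| "fv_raw (RIf e f r s) = fv_expr e \<union> fv_expr f \<union> fv_raw r \<union> fv_raw s"

lemma lc_abs_ref: "lc_ref i m \<Longrightarrow> lc_ref (Suc i) (abs_ref n i m)"
  by (cases m) (auto simp: abs_ref_def)

lemma lc_abs_expr: "lc_expr k e \<Longrightarrow> lc_expr (Suc k) (map_vars (abs_ref x k) e)"
  by (auto simp: lc_expr_def expr.set_map lc_abs_ref)

lemma vars_subst_expr: "vars (subst_expr x v e) = vars e - {x}"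
  by (induction e) auto

lemma lc_subst_expr: "lc_expr k e \<Longrightarrow> lc_expr k (subst_expr x v e)"
  by (auto simp: lc_expr_def vars_subst_expr)

lemma lc_embed_expr: "lc_expr k (map_vars Free e)"
  by (auto simp: lc_expr_def expr.set_map)

lemma lc_trav:
  assumes "\<And>i m. lc_ref i m \<Longrightarrow> lc_ref (i + di) (H i m)"
    and "\<And>j m. lc_ref j m \<Longrightarrow> lc_ref (j + dj) (F j m)"
    and "\<And>k e. lc_expr k e \<Longrightarrow> lc_expr (k + dk) (E k e)"
  shows "lc i j k r \<Longrightarrow> lc (i + di) (j + dj) (k + dk) (trav H F E i j k r)"
  by (induction r arbitrary: i j k) (use assms in \<open>force simp flip: add_Suc\<close>)+

lemma lc_abs_h: "lc 0 0 0 r \<Longrightarrow> lc (Suc 0) 0 0 (abs_h b r)"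
  using lc_trav[of 1 "abs_ref b" 0 keep 0 keep 0 0 0 r] by (simp add: abs_h_def lc_abs_ref)

lemma lc_abs_f: "lc 0 0 0 r \<Longrightarrow> lc 0 (Suc 0) 0 (abs_f h r)"
  using lc_trav[of 0 keep 1 "abs_ref h" 0 keep 0 0 0 r] by (simp add: abs_f_def lc_abs_ref)

lemma lc_abs_v: "lc 0 0 0 r \<Longrightarrow> lc 0 0 (Suc 0) (abs_v x r)"
  using lc_trav[of 0 keep 0 keep 1 "\<lambda>k. map_vars (abs_ref x k)" 0 0 0 r]
  by (simp add: abs_v_def lc_abs_expr)

lemma lc_abs_hv: "lc 0 0 0 r \<Longrightarrow> lc (Suc 0) 0 (Suc 0) (abs_hv b x r)"
  using lc_trav[of 1 "abs_ref b" 0 keep 1 "\<lambda>k. map_vars (abs_ref x k)" 0 0 0 r]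
  by (simp add: abs_hv_def lc_abs_ref lc_abs_expr)

lemma lc_subst_raw: "lc 0 0 0 r \<Longrightarrow> lc 0 0 0 (subst_raw r x v)"
  using lc_trav[of 0 keep 0 keep 0 "\<lambda>_. subst_expr (Free x) v" 0 0 0 r]
  by (simp add: subst_raw_def lc_subst_expr)

typedef ('f, 'v) proc = "{r :: ('f, 'v) raw. lc 0 0 0 r}"
  by (rule exI[of _ RNil]) simp

setup_lifting type_definition_proc

text \<open>
  In the constructors below, \<open>HIn a x b P\<close> is \<open>a(x,b).P\<close>, \<open>FIn h x P\<close> is \<open>h(x).P\<close>,
  \<open>HOut a e b P\<close> is the output of \<open>e\<close> at \<open>a\<close> with bound name \<open>b\<close>, \<open>HBang a x b P\<close> is \<open>!a(x,b).P\<close>,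
  and \<open>FBang h x P\<close> is \<open>!h(x).P\<close>.
\<close>

lift_definition HIn :: "hname \<Rightarrow> var \<Rightarrow> hname \<Rightarrow> ('f, 'v) proc \<Rightarrow> ('f, 'v) proc"
  is "\<lambda>a x b r. RHIn (Free a) (abs_hv b x r)"
  by (simp add: lc_abs_hv)

lift_definition FIn :: "fname \<Rightarrow> var \<Rightarrow> ('f, 'v) proc \<Rightarrow> ('f, 'v) proc"
  is "\<lambda>h x r. RFIn (Free h) (abs_v x r)"
  by (simp add: lc_abs_v)

lift_definition HOut :: "hname \<Rightarrow> ('f, 'v, var) expr \<Rightarrow> hname \<Rightarrow> ('f, 'v) proc \<Rightarrow> ('f, 'v) proc"
  is "\<lambda>a e b r. RHOut (Free a) (map_vars Free e) (abs_h b r)"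
  by (simp add: lc_abs_h lc_embed_expr)

lift_definition FOut :: "fname \<Rightarrow> ('f, 'v, var) expr \<Rightarrow> ('f, 'v) proc \<Rightarrow> ('f, 'v) proc"
  is "\<lambda>h e r. RFOut (Free h) (map_vars Free e) r"
  by (simp add: lc_embed_expr)

lift_definition Succ :: "sname \<Rightarrow> ('f, 'v) proc \<Rightarrow> ('f, 'v) proc" is RSucc
  by simp

lift_definition HBang :: "hname \<Rightarrow> var \<Rightarrow> hname \<Rightarrow> ('f, 'v) proc \<Rightarrow> ('f, 'v) proc"
  is "\<lambda>a x b r. RHBang (Free a) (abs_hv b x r)"
  by (simp add: lc_abs_hv)

lift_definition FBang :: "fname \<Rightarrow> var \<Rightarrow> ('f, 'v) proc \<Rightarrow> ('f, 'v) proc"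
  is "\<lambda>h x r. RFBang (Free h) (abs_v x r)"
  by (simp add: lc_abs_v)

lift_definition Par :: "('f, 'v) proc \<Rightarrow> ('f, 'v) proc \<Rightarrow> ('f, 'v) proc" is RPar
  by simp

lift_definition HNu :: "hname \<Rightarrow> ('f, 'v) proc \<Rightarrow> ('f, 'v) proc" is "\<lambda>a r. RHNu (abs_h a r)"
  by (simp add: lc_abs_h)

lift_definition FNu :: "fname \<Rightarrow> ('f, 'v) proc \<Rightarrow> ('f, 'v) proc" is "\<lambda>h r. RFNu (abs_f h r)"
  by (simp add: lc_abs_f)

lift_definition PNil :: "('f, 'v) proc" is RNil
  by simp

lift_definition Sum :: "('f, 'v) proc \<Rightarrow> ('f, 'v) proc \<Rightarrow> ('f, 'v) proc" is RSum
  by simp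

lift_definition Cond :: "('f, 'v, var) expr \<Rightarrow> ('f, 'v, var) expr \<Rightarrow>
    ('f, 'v) proc \<Rightarrow> ('f, 'v) proc \<Rightarrow> ('f, 'v) proc"
  is "\<lambda>e f r s. RIf (map_vars Free e) (map_vars Free f) r s"
  by (simp add: lc_embed_expr)

lift_definition subst :: "('f, 'v) proc \<Rightarrow> var \<Rightarrow> 'v \<Rightarrow> ('f, 'v) proc" is subst_raw
  by (rule lc_subst_raw)

text \<open>Free higher-order names; the other classes of names need no freshness conditions.\<close>

lift_definition fn :: "('f, 'v) proc \<Rightarrow> hname set" is fn_raw .

lift_definition fv :: "('f, 'v) proc \<Rightarrow> var set" is fv_raw .

definition closed_proc :: "('f, 'v) proc \<Rightarrow> bool" where
  "closed_proc P \<longleftrightarrow> fv P = {}"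


section \<open>Transitions\<close>

datatype 'v act =
    Tau
  | AHIn hname 'v hname
  | AHOut hname 'v hname
  | AFIn fname 'v
  | AFOut fname 'v
  | ASucc sname

fun bn :: "'v act \<Rightarrow> hname set" where
  "bn (AHIn a v b) = {b}"
| "bn (AHOut a v b) = {b}"
| "bn _ = {}"

fun hnames :: "'v act \<Rightarrow> hname set" where
  "hnames (AHIn a v b) = {a, b}"
| "hnames (AHOut a v b) = {a, b}"
| "hnames _ = {}"

fun fnames :: "'v act \<Rightarrow> fname set" where
  "fnames (AFIn h v) = {h}"
| "fnames (AFOut h v) = {h}"
| "fnames _ = {}"

text \<open>
  The side conditions involving \<open>bn\<close> make precise the convention that the bound name of an action
  is fresh: they ensure that it is never free in the source of the transition.
\<close>

inductive lts :: "('f \<Rightarrow> 'v list \<Rightarrow> 'v) \<Rightarrow> ('f, 'v) proc \<Rightarrow> 'v act \<Rightarrow> ('f, 'v) proc \<Rightarrow> bool"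
  for I :: "'f \<Rightarrow> 'v list \<Rightarrow> 'v" where
  lts_HIn: "b \<noteq> a \<Longrightarrow> lts I (HIn a x b P) (AHIn a v b) (subst P x v)"
| lts_HOut: "eval I e v \<Longrightarrow> b \<noteq> a \<Longrightarrow> lts I (HOut a e b P) (AHOut a v b) P"
| lts_FIn: "lts I (FIn h x P) (AFIn h v) (subst P x v)"
| lts_FOut: "eval I e v \<Longrightarrow> lts I (FOut h e P) (AFOut h v) P"
| lts_Succ: "lts I (Succ w P) (ASucc w) PNil"
| lts_HBang: "lts I (Par (HIn a x b P) (HBang a x b P)) \<mu> P' \<Longrightarrow> lts I (HBang a x b P) \<mu> P'"
| lts_FBang: "lts I (Par (FIn h x P) (FBang h x P)) \<mu> P' \<Longrightarrow> lts I (FBang h x P) \<mu> P'"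
| lts_HNu: "lts I P \<mu> P' \<Longrightarrow> a \<notin> hnames \<mu> \<Longrightarrow> lts I (HNu a P) \<mu> (HNu a P')"
| lts_FNu: "lts I P \<mu> P' \<Longrightarrow> h \<notin> fnames \<mu> \<Longrightarrow> lts I (FNu h P) \<mu> (FNu h P')"
| lts_SumL: "lts I P \<mu> P' \<Longrightarrow> bn \<mu> \<inter> fn Q = {} \<Longrightarrow> lts I (Sum P Q) \<mu> P'"
| lts_SumR: "lts I Q \<mu> Q' \<Longrightarrow> bn \<mu> \<inter> fn P = {} \<Longrightarrow> lts I (Sum P Q) \<mu> Q'"
| lts_ParL: "lts I P \<mu> P' \<Longrightarrow> bn \<mu> \<inter> fn Q = {} \<Longrightarrow> lts I (Par P Q) \<mu> (Par P' Q)"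
| lts_ParR: "lts I Q \<mu> Q' \<Longrightarrow> bn \<mu> \<inter> fn P = {} \<Longrightarrow> lts I (Par P Q) \<mu> (Par P Q')"
| lts_HComL: "lts I P (AHIn a v b) P' \<Longrightarrow> lts I Q (AHOut a v b) Q' \<Longrightarrow>
    lts I (Par P Q) Tau (HNu b (Par P' Q'))"
| lts_HComR: "lts I P (AHOut a v b) P' \<Longrightarrow> lts I Q (AHIn a v b) Q' \<Longrightarrow>
    lts I (Par P Q) Tau (HNu b (Par P' Q'))"
| lts_FComL: "lts I P (AFIn h v) P' \<Longrightarrow> lts I Q (AFOut h v) Q' \<Longrightarrow>
    lts I (Par P Q) Tau (Par P' Q')"
| lts_FComR: "lts I P (AFOut h v) P' \<Longrightarrow> lts I Q (AFIn h v) Q' \<Longrightarrow>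
    lts I (Par P Q) Tau (Par P' Q')"
| lts_CondT: "eval I e v \<Longrightarrow> eval I f v \<Longrightarrow> lts I P \<mu> P' \<Longrightarrow> bn \<mu> \<inter> fn Q = {} \<Longrightarrow>
    lts I (Cond e f P Q) \<mu> P'"
| lts_CondF: "eval I e v \<Longrightarrow> eval I f w \<Longrightarrow> v \<noteq> w \<Longrightarrow> lts I Q \<mu> Q' \<Longrightarrow> bn \<mu> \<inter> fn P = {} \<Longrightarrow>
    lts I (Cond e f P Q) \<mu> Q'"

definition red :: "('f \<Rightarrow> 'v list \<Rightarrow> 'v) \<Rightarrow> ('f, 'v) proc \<Rightarrow> ('f, 'v) proc \<Rightarrow> bool" where
  "red I P P' \<longleftrightarrow> lts I P Tau P'"

definition reds :: "('f \<Rightarrow> 'v list \<Rightarrow> 'v) \<Rightarrow> ('f, 'v) proc \<Rightarrow> ('f, 'v) proc \<Rightarrow> bool" where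
  "reds I = (red I)\<^sup>*\<^sup>*"

definition weak_barb :: "('f \<Rightarrow> 'v list \<Rightarrow> 'v) \<Rightarrow> ('f, 'v) proc \<Rightarrow> sname \<Rightarrow> bool" where
  "weak_barb I P w \<longleftrightarrow> (\<exists>P' P''. reds I P P' \<and> lts I P' (ASucc w) P'')"


section \<open>Visibility functions and typing\<close>

datatype point = Cur | Nm hname

type_synonym vis = "point \<Rightarrow> hname set option"

definition visibility :: "vis \<Rightarrow> bool" where
  "visibility \<Delta> \<longleftrightarrow> finite (dom \<Delta>) \<and> (\<forall>V \<in> ran \<Delta>. finite V) \<and>
     (\<forall>p a V W. \<Delta> p = Some V \<and> \<Delta> (Nm a) = Some W \<and> a \<in> V \<longrightarrow> W \<subseteq> V)"

definition vis_names :: "vis \<Rightarrow> hname set" where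
  "vis_names \<Delta> = {a. Nm a \<in> dom \<Delta>} \<union> \<Union> (ran \<Delta>)"

definition erase :: "vis \<Rightarrow> point \<Rightarrow> vis" where
  "erase \<Delta> p = (\<lambda>q. if q = p then None else map_option (\<lambda>V. {a \<in> V. Nm a \<noteq> p}) (\<Delta> q))"

definition vis_un :: "vis \<Rightarrow> vis \<Rightarrow> vis" where
  "vis_un \<Delta>1 \<Delta>2 = (\<lambda>p. case (\<Delta>1 p, \<Delta>2 p) of
     (Some V, Some W) \<Rightarrow> Some (V \<union> W)
   | (Some V, None) \<Rightarrow> Some V
   | (None, W) \<Rightarrow> W)"

definition compatible :: "vis \<Rightarrow> vis \<Rightarrow> bool" where
  "compatible \<Delta> \<Gamma> \<longleftrightarrow> Cur \<notin> dom \<Delta> \<inter> dom \<Gamma>"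

definition split :: "vis \<Rightarrow> (vis \<times> vis) set" where
  "split \<Delta> = {(\<Delta>1, \<Delta>2). visibility \<Delta>1 \<and> visibility \<Delta>2 \<and> vis_un \<Delta>1 \<Delta>2 = \<Delta> \<and>
     Cur \<notin> dom \<Delta>1 \<inter> dom \<Delta>2}"

text \<open>
  The premises \<open>visibility \<Delta>\<close> keep every context in a derivation a visibility function; a bound
  name that enters a context is fresh for it.
\<close>

inductive typed :: "vis \<Rightarrow> ('f, 'v) proc \<Rightarrow> bool" where
  typed_HOut: "visibility \<Delta> \<Longrightarrow> \<Delta> Cur = Some V \<Longrightarrow> a \<in> V \<Longrightarrow> b \<notin> vis_names \<Delta> \<Longrightarrow>
    typed ((erase \<Delta> Cur)(Nm b \<mapsto> V \<union> {b})) P \<Longrightarrow> typed \<Delta> (HOut a e b P)"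
| typed_HIn: "visibility \<Delta> \<Longrightarrow> Cur \<notin> dom \<Delta> \<Longrightarrow> \<Delta> (Nm a) = Some V \<Longrightarrow> b \<notin> vis_names \<Delta> \<Longrightarrow>
    typed (\<Delta>(Cur \<mapsto> V \<union> {b})) P \<Longrightarrow> typed \<Delta> (HIn a x b P)"
| typed_FOut: "typed \<Delta> P \<Longrightarrow> Cur \<notin> dom \<Delta> \<Longrightarrow> typed \<Delta> (FOut h e P)"
| typed_FIn: "typed \<Delta> P \<Longrightarrow> Cur \<in> dom \<Delta> \<Longrightarrow> typed \<Delta> (FIn h x P)"
| typed_HBang: "typed \<Delta> (HIn a x b P) \<Longrightarrow> Cur \<notin> dom \<Delta> \<Longrightarrow> typed \<Delta> (HBang a x b P)"
| typed_FBang: "typed \<Delta> (FIn h x P) \<Longrightarrow> Cur \<notin> dom \<Delta> \<Longrightarrow> typed \<Delta> (FBang h x P)"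
| typed_Succ: "visibility \<Delta> \<Longrightarrow> typed \<Delta> (Succ w P)"
| typed_HNu: "typed \<Delta> P \<Longrightarrow> typed (erase \<Delta> (Nm a)) (HNu a P)"
| typed_FNu: "typed \<Delta> P \<Longrightarrow> typed \<Delta> (FNu h P)"
| typed_PNil: "visibility \<Delta> \<Longrightarrow> Cur \<notin> dom \<Delta> \<Longrightarrow> typed \<Delta> PNil"
| typed_Sum: "typed \<Delta> P \<Longrightarrow> typed \<Delta> Q \<Longrightarrow> typed \<Delta> (Sum P Q)"
| typed_Cond: "typed \<Delta> P \<Longrightarrow> typed \<Delta> Q \<Longrightarrow> typed \<Delta> (Cond e f P Q)"
| typed_Par: "visibility \<Delta> \<Longrightarrow> (\<Delta>1, \<Delta>2) \<in> split \<Delta> \<Longrightarrow> typed \<Delta>1 P1 \<Longrightarrow> typed \<Delta>2 P2 \<Longrightarrow>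
    typed \<Delta> (Par P1 P2)"


section \<open>Barbed equivalence\<close>

definition barbed_bisimulation ::
    "('f \<Rightarrow> 'v list \<Rightarrow> 'v) \<Rightarrow> (('f, 'v) proc \<times> ('f, 'v) proc) set \<Rightarrow> bool" where
  "barbed_bisimulation I \<R> \<longleftrightarrow> sym \<R> \<and>
     (\<forall>(P, Q) \<in> \<R>.
        (\<forall>P'. red I P P' \<longrightarrow> (\<exists>Q'. reds I Q Q' \<and> (P', Q') \<in> \<R>)) \<and>
        (\<forall>w. weak_barb I P w \<longrightarrow> weak_barb I Q w))"

definition barbed_bisimilar ::
    "('f \<Rightarrow> 'v list \<Rightarrow> 'v) \<Rightarrow> ('f, 'v) proc \<Rightarrow> ('f, 'v) proc \<Rightarrow> bool" where
  "barbed_bisimilar I P Q \<longleftrightarrow> (\<exists>\<R>. barbed_bisimulation I \<R> \<and> (P, Q) \<in> \<R>)"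

definition barbed_equivalent ::
    "('f \<Rightarrow> 'v list \<Rightarrow> 'v) \<Rightarrow> vis \<Rightarrow> ('f, 'v) proc \<Rightarrow> ('f, 'v) proc \<Rightarrow> bool" where
  "barbed_equivalent I \<Gamma> P Q \<longleftrightarrow>
     (\<forall>R. closed_proc R \<and> typed \<Gamma> R \<longrightarrow> barbed_bisimilar I (Par P R) (Par Q R))"


section \<open>Typed bisimilarity\<close>

text \<open>
  Success actions are allowed under every \<open>\<Gamma>\<close>, as \<open>Succ w P\<close> is typable in every context.  If they
  were not observed, \<open>Succ w PNil\<close> and \<open>PNil\<close> would be typed bisimilar but not barbed equivalent.
  The rule has no effect on processes in which success names do not occur.
\<close>

inductive ttrans :: "('f \<Rightarrow> 'v list \<Rightarrow> 'v) \<Rightarrow>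
    vis \<Rightarrow> ('f, 'v) proc \<Rightarrow> 'v act \<Rightarrow> vis \<Rightarrow> ('f, 'v) proc \<Rightarrow> bool"
  for I :: "'f \<Rightarrow> 'v list \<Rightarrow> 'v" where
  ttrans_HOut: "lts I P (AHOut a v b) P' \<Longrightarrow> \<Gamma> (Nm a) = Some V \<Longrightarrow> Cur \<notin> dom \<Gamma> \<Longrightarrow>
    b \<notin> vis_names \<Gamma> \<Longrightarrow> ttrans I \<Gamma> P (AHOut a v b) (\<Gamma>(Cur \<mapsto> V \<union> {b})) P'"
| ttrans_HIn: "lts I P (AHIn a v b) P' \<Longrightarrow> \<Gamma> Cur = Some V \<Longrightarrow> a \<in> V \<Longrightarrow>
    b \<notin> vis_names \<Gamma> \<Longrightarrow> ttrans I \<Gamma> P (AHIn a v b) ((erase \<Gamma> Cur)(Nm b \<mapsto> V \<union> {b})) P'"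
| ttrans_FOut: "lts I P (AFOut h v) P' \<Longrightarrow> Cur \<in> dom \<Gamma> \<Longrightarrow> ttrans I \<Gamma> P (AFOut h v) \<Gamma> P'"
| ttrans_FIn: "lts I P (AFIn h v) P' \<Longrightarrow> Cur \<notin> dom \<Gamma> \<Longrightarrow> ttrans I \<Gamma> P (AFIn h v) \<Gamma> P'"
| ttrans_Tau: "lts I P Tau P' \<Longrightarrow> Cur \<notin> dom \<Gamma> \<Longrightarrow> ttrans I \<Gamma> P Tau \<Gamma> P'"
| ttrans_Succ: "lts I P (ASucc w) P' \<Longrightarrow> ttrans I \<Gamma> P (ASucc w) \<Gamma> P'"

definition ttaus :: "('f \<Rightarrow> 'v list \<Rightarrow> 'v) \<Rightarrow> vis \<Rightarrow> ('f, 'v) proc \<Rightarrow> ('f, 'v) proc \<Rightarrow> bool" where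
  "ttaus I \<Gamma> = (\<lambda>P P'. ttrans I \<Gamma> P Tau \<Gamma> P')\<^sup>*\<^sup>*"

definition wtrans :: "('f \<Rightarrow> 'v list \<Rightarrow> 'v) \<Rightarrow>
    vis \<Rightarrow> ('f, 'v) proc \<Rightarrow> 'v act \<Rightarrow> vis \<Rightarrow> ('f, 'v) proc \<Rightarrow> bool" where
  "wtrans I \<Gamma> P \<mu> \<Gamma>' P' \<longleftrightarrow>
     (if \<mu> = Tau then \<Gamma>' = \<Gamma> \<and> ttaus I \<Gamma> P P'
      else \<exists>P1 P2. ttaus I \<Gamma> P P1 \<and> ttrans I \<Gamma> P1 \<mu> \<Gamma>' P2 \<and> ttaus I \<Gamma>' P2 P')"

text \<open>
  Following the convention on bound names of actions, a bound name \<open>b\<close> is chosen fresh for both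
  processes that are compared.
\<close>

definition typed_bisimulation ::
    "('f \<Rightarrow> 'v list \<Rightarrow> 'v) \<Rightarrow> (vis \<times> ('f, 'v) proc \<times> ('f, 'v) proc) set \<Rightarrow> bool" where
  "typed_bisimulation I \<R> \<longleftrightarrow>
     (\<forall>(\<Gamma>, P, Q) \<in> \<R>. visibility \<Gamma> \<and>
        (\<forall>\<mu> \<Gamma>' P'. ttrans I \<Gamma> P \<mu> \<Gamma>' P' \<and> bn \<mu> \<inter> fn Q = {} \<longrightarrow>
           (\<exists>Q'. wtrans I \<Gamma> Q \<mu> \<Gamma>' Q' \<and> (\<Gamma>', P', Q') \<in> \<R>)) \<and>
        (\<forall>\<mu> \<Gamma>' Q'. ttrans I \<Gamma> Q \<mu> \<Gamma>' Q' \<and> bn \<mu> \<inter> fn P = {} \<longrightarrow>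
           (\<exists>P'. wtrans I \<Gamma> P \<mu> \<Gamma>' P' \<and> (\<Gamma>', P', Q') \<in> \<R>)))"

definition typed_bisimilarity ::
    "('f \<Rightarrow> 'v list \<Rightarrow> 'v) \<Rightarrow> (vis \<times> ('f, 'v) proc \<times> ('f, 'v) proc) set" where
  "typed_bisimilarity I = \<Union> {\<R>. typed_bisimulation I \<R>}"

definition typed_bisimilar ::
    "('f \<Rightarrow> 'v list \<Rightarrow> 'v) \<Rightarrow> vis \<Rightarrow> vis \<Rightarrow> ('f, 'v) proc \<Rightarrow> ('f, 'v) proc \<Rightarrow> bool" where
  "typed_bisimilar I \<Delta> \<Gamma> P Q \<longleftrightarrow> (\<Gamma>, P, Q) \<in> typed_bisimilarity I \<and> compatible \<Delta> \<Gamma>"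

end

theory Submission
  imports Defs "HOL-Combinatorics.Transposition"
begin

text \<open>
  The relation that pairs \<open>P | R\<close> with \<open>Q | R\<close> for typed bisimilar \<open>P\<close>, \<open>Q\<close> and an observer \<open>R\<close>
  typed by \<open>\<Gamma>\<close>, closed under restriction, is a barbed bisimulation.  Subject reduction for \<open>R\<close>
  shows that each synchronisation of \<open>P\<close> with \<open>R\<close> is a type-allowed transition of \<open>P\<close> and that the
  residual of \<open>R\<close> is typed by the resulting visibility function.  Outputs on higher-order names,
  inputs on first-order names and internal steps all need \<open>Cur\<close>, and \<open>Cur\<close> is never shared between
  process and observer; so \<open>P\<close> can only make such a move while \<open>\<Gamma>\<close> has no \<open>Cur\<close>, which is when the
  typed transitions allow it.

  Subject reduction is proved for a coarser, weakening-closed type system in which names are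
  mapped to nodes and every binder adds the node 0 and shifts the others.  Restrictions and bound
  names of actions then never have to be renamed in typing arguments.
\<close>

section \<open>Renaming and alpha-conversion\<close>

text \<open>Subject reduction is awkward for \<open>typed\<close> itself because its contexts are
  exact: a split must recombine to the very context, \<open>typed_HNu\<close> concludes only for
  contexts \<open>erase \<Delta> (Nm a)\<close>, and a binder must be fresh for the whole context,
  whereas a transition only keeps its bound name out of the free names of its source. A
  communication at \<open>a\<close> also forces weakening. The receiver expects to see what
  \<open>a\<close> sees plus the new name, but the new name itself sees everything the sender saw,
  so by transitivity the receiver has to be typed with the sender's larger set. That the two sets
  are comparable is again transitivity, applied to the sender, which sees \<open>a\<close>.
  Weakening must then respect transitivity, and the delicate case is restriction, where a hidden
  node has to be placed in a larger context. \<open>Cur\<close> is exempt from weakening: it acts as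
  a token that a parallel composition never duplicates.\<close>

lemma trav_trav:
  "trav H F E i j k (trav H' F' E' i j k r) =
   trav (\<lambda>i m. H i (H' i m)) (\<lambda>j m. F j (F' j m)) (\<lambda>k e. E k (E' k e)) i j k r"
  by (induction r arbitrary: i j k) auto

lemma trav_keep: "trav keep keep keep i j k r = r"
  by (induction r arbitrary: i j k) auto

text \<open>Two traversals only have to agree on references that can occur, which excludes dangling
  indices and foreign names. All alpha-conversion arguments reduce to this.\<close>

lemma trav_cong:
  assumes "lc i j k r"
    and "\<And>i m. lc_ref i m \<Longrightarrow> (\<And>n. m = Free n \<Longrightarrow> n \<in> fn_raw r) \<Longrightarrow> H i m = H' i m"
  shows "trav H F E i j k r = trav H' F E i j k r"
  using assms by (induction r arbitrary: i j k) auto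

text \<open>The partial map \<open>g\<close> covers both uses: abstraction sends the bound name to
  \<open>None\<close>, renaming has a total \<open>g\<close>.\<close>

lemma fn_trav:
  assumes "\<And>i m n. H i m = Free n \<longleftrightarrow> (\<exists>n'. m = Free n' \<and> g n' = Some n)"
  shows "fn_raw (trav H F E i j k r) = {n. \<exists>n' \<in> fn_raw r. g n' = Some n}"
  by (induction r arbitrary: i j k) (auto simp: assms)

lemma fn_trav_abs: "fn_raw (trav (abs_ref b) F E i j k r) = fn_raw r - {b}"
proof -
  have "fn_raw (trav (abs_ref b) F E i j k r) =
      {n. \<exists>n' \<in> fn_raw r. (if n' = b then None else Some n') = Some n}"
    by (rule fn_trav) (auto simp: abs_ref_def)
  then show ?thesis
    by (auto split: if_splits)
qed

lemma fn_trav_keep: "fn_raw (trav keep F E i j k r) = fn_raw r"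
  using fn_trav[of keep Some F E i j k r] by auto

section \<open>Free higher-order names of processes and transitions\<close>

lemma fn_HIn [simp]: "fn (HIn a x b P) = insert a (fn P - {b})"
  by transfer (auto simp: abs_hv_def fn_trav_abs)

lemma fn_FIn [simp]: "fn (FIn h x P) = fn P"
  by transfer (auto simp: abs_v_def fn_trav_keep)

lemma fn_HOut [simp]: "fn (HOut a e b P) = insert a (fn P - {b})"
  by transfer (auto simp: abs_h_def fn_trav_abs)

lemma fn_FOut [simp]: "fn (FOut h e P) = fn P"
  by transfer auto

lemma fn_HBang [simp]: "fn (HBang a x b P) = insert a (fn P - {b})"
  by transfer (auto simp: abs_hv_def fn_trav_abs)

lemma fn_FBang [simp]: "fn (FBang h x P) = fn P"
  by transfer (auto simp: abs_v_def fn_trav_keep)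

lemma fn_HNu [simp]: "fn (HNu a P) = fn P - {a}"
  by transfer (auto simp: abs_h_def fn_trav_abs)

lemma fn_FNu [simp]: "fn (FNu h P) = fn P"
  by transfer (auto simp: abs_f_def fn_trav_keep)

lemma fn_Par [simp]: "fn (Par P Q) = fn P \<union> fn Q"
  by transfer auto

lemma fn_PNil [simp]: "fn PNil = {}"
  by transfer auto

lemma fn_Sum [simp]: "fn (Sum P Q) = fn P \<union> fn Q"
  by transfer auto

lemma fn_Cond [simp]: "fn (Cond e f P Q) = fn P \<union> fn Q"
  by transfer auto

lemma fn_subst [simp]: "fn (subst P x v) = fn P"
  by transfer (auto simp: subst_raw_def fn_trav_keep)

lemma finite_fn: "finite (fn P)"
proof transfer
  fix r :: "('f, 'v) raw"
  have fin: "finite {n. a = Free n}" for a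
    by (cases a) auto
  show "finite (fn_raw r)"
    by (induction r) (auto simp: fin)
qed

lemma lts_bn_fresh: "lts I P \<mu> P' \<Longrightarrow> bn \<mu> \<inter> fn P = {}"
proof (induction rule: lts.induct)
  case (lts_HNu P \<mu> P' a)
  then show ?case by (cases \<mu>) auto
qed auto

lemma lts_fn: "lts I P \<mu> P' \<Longrightarrow> fn P' \<subseteq> fn P \<union> bn \<mu>"
  by (induction rule: lts.induct) auto

section \<open>Renaming of higher-order names\<close>

primrec map_ref :: "(nat \<Rightarrow> nat) \<Rightarrow> ref \<Rightarrow> ref" where
  "map_ref \<pi> (Free n) = Free (\<pi> n)"
| "map_ref \<pi> (Bound i) = Bound i"

lemma lc_map_ref [simp]: "lc_ref i (map_ref \<pi> m) = lc_ref i m"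
  by (cases m) auto

lift_definition rename :: "(hname \<Rightarrow> hname) \<Rightarrow> ('f, 'v) proc \<Rightarrow> ('f, 'v) proc"
  is "\<lambda>\<pi>. trav (\<lambda>_. map_ref \<pi>) keep keep 0 0 0"
  subgoal for \<pi> r
    using lc_trav[of 0 "\<lambda>_. map_ref \<pi>" 0 keep 0 keep 0 0 0 r] by simp
  done

text \<open>Injectivity excludes capture: no other name is sent to \<open>\<pi> b\<close>. Hence
  binders may be renamed along with everything else.\<close>

lemma map_ref_abs_ref:
  "inj \<pi> \<Longrightarrow> map_ref \<pi> (abs_ref b i m) = abs_ref (\<pi> b) i (map_ref \<pi> m)"
  by (cases m) (auto simp: abs_ref_def dest: injD)

text \<open>A renaming ignores the binder depth, so the traversal found under a binder, started at
  depth 1, is again \<open>rename\<close>.\<close>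

lemma trav_depth_0:
  "trav (\<lambda>_. f) keep keep i j k r = trav (\<lambda>_. f) keep keep 0 0 0 r"
proof -
  have "trav (\<lambda>_. f) keep keep i j k r = trav (\<lambda>_. f) keep keep i' j' k' r" for i' j' k'
    by (induction r arbitrary: i j k i' j' k') auto
  then show ?thesis .
qed

lemma rename_HIn [simp]:
  "inj \<pi> \<Longrightarrow> rename \<pi> (HIn a x b P) = HIn (\<pi> a) x (\<pi> b) (rename \<pi> P)"
  by transfer (simp add: abs_hv_def trav_trav map_ref_abs_ref trav_depth_0[of _ "Suc 0"])

lemma rename_FIn [simp]: "rename \<pi> (FIn h x P) = FIn h x (rename \<pi> P)"
  by transfer (simp add: abs_v_def trav_trav trav_depth_0[of _ _ _ "Suc 0"])

lemma rename_HOut [simp]: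
  "inj \<pi> \<Longrightarrow> rename \<pi> (HOut a e b P) = HOut (\<pi> a) e (\<pi> b) (rename \<pi> P)"
  by transfer (simp add: abs_h_def trav_trav map_ref_abs_ref trav_depth_0[of _ "Suc 0"])

lemma rename_FOut [simp]: "rename \<pi> (FOut h e P) = FOut h e (rename \<pi> P)"
  by transfer simp

lemma rename_Succ [simp]: "rename \<pi> (Succ w P) = Succ w (rename \<pi> P)"
  by transfer simp

lemma rename_HBang [simp]:
  "inj \<pi> \<Longrightarrow> rename \<pi> (HBang a x b P) = HBang (\<pi> a) x (\<pi> b) (rename \<pi> P)"
  by transfer (simp add: abs_hv_def trav_trav map_ref_abs_ref trav_depth_0[of _ "Suc 0"])

lemma rename_FBang [simp]: "rename \<pi> (FBang h x P) = FBang h x (rename \<pi> P)"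
  by transfer (simp add: abs_v_def trav_trav trav_depth_0[of _ _ _ "Suc 0"])

lemma rename_Par [simp]: "rename \<pi> (Par P Q) = Par (rename \<pi> P) (rename \<pi> Q)"
  by transfer simp

lemma rename_HNu [simp]: "inj \<pi> \<Longrightarrow> rename \<pi> (HNu a P) = HNu (\<pi> a) (rename \<pi> P)"
  by transfer (simp add: abs_h_def trav_trav map_ref_abs_ref trav_depth_0[of _ "Suc 0"])

lemma rename_FNu [simp]: "rename \<pi> (FNu h P) = FNu h (rename \<pi> P)"
  by transfer (simp add: abs_f_def trav_trav trav_depth_0[of _ _ "Suc 0"])

lemma rename_PNil [simp]: "rename \<pi> PNil = PNil"
  by transfer simp

lemma rename_Sum [simp]: "rename \<pi> (Sum P Q) = Sum (rename \<pi> P) (rename \<pi> Q)"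
  by transfer simp

lemma rename_Cond [simp]: "rename \<pi> (Cond e f P Q) = Cond e f (rename \<pi> P) (rename \<pi> Q)"
  by transfer simp

lemma rename_subst [simp]: "rename \<pi> (subst P x v) = subst (rename \<pi> P) x v"
  by transfer (simp add: subst_raw_def trav_trav)

lemma fn_rename [simp]: "fn (rename \<pi> P) = \<pi> ` fn P"
proof transfer
  fix \<pi> and r :: "('f, 'v) raw"
  have "fn_raw (trav (\<lambda>_. map_ref \<pi>) keep keep 0 0 0 r) =
      {n. \<exists>n' \<in> fn_raw r. Some (\<pi> n') = Some n}"
  proof (rule fn_trav)
    show "map_ref \<pi> m = Free n \<longleftrightarrow> (\<exists>n'. m = Free n' \<and> Some (\<pi> n') = Some n)" for m n
      by (cases m) auto
  qed
  then show "fn_raw (trav (\<lambda>_. map_ref \<pi>) keep keep 0 0 0 r) = \<pi> ` fn_raw r"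
    by auto
qed

lemma rename_fresh: "(\<And>n. n \<in> fn P \<Longrightarrow> \<pi> n = n) \<Longrightarrow> rename \<pi> P = P"
proof (transfer, goal_cases)
  case (1 r \<pi>)
  have "trav (\<lambda>_. map_ref \<pi>) keep keep 0 0 0 r = trav keep keep keep 0 0 0 r"
  proof (rule trav_cong[OF 1(1)])
    show "map_ref \<pi> m = m" if "\<And>n. m = Free n \<Longrightarrow> n \<in> fn_raw r" for m
      using that 1(2) by (cases m) auto
  qed
  then show ?case by (simp add: trav_keep)
qed

primrec rename_act :: "(hname \<Rightarrow> hname) \<Rightarrow> 'v act \<Rightarrow> 'v act" where
  "rename_act \<pi> Tau = Tau"
| "rename_act \<pi> (AHIn a v b) = AHIn (\<pi> a) v (\<pi> b)"
| "rename_act \<pi> (AHOut a v b) = AHOut (\<pi> a) v (\<pi> b)"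
| "rename_act \<pi> (AFIn h v) = AFIn h v"
| "rename_act \<pi> (AFOut h v) = AFOut h v"
| "rename_act \<pi> (ASucc w) = ASucc w"

lemma bn_rename_act [simp]: "bn (rename_act \<pi> \<mu>) = \<pi> ` bn \<mu>"
  by (cases \<mu>) auto

lemma hnames_rename_act [simp]: "hnames (rename_act \<pi> \<mu>) = \<pi> ` hnames \<mu>"
  by (cases \<mu>) auto

lemma fnames_rename_act [simp]: "fnames (rename_act \<pi> \<mu>) = fnames \<mu>"
  by (cases \<mu>) auto

lemma inj_image_disjoint_iff: "inj f \<Longrightarrow> f ` A \<inter> f ` B = {} \<longleftrightarrow> A \<inter> B = {}"
  by (simp flip: image_Int)

text \<open>Equivariance: every side condition is a disequality or a disjointness of names, and
  injective maps preserve both.\<close>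

lemma lts_rename:
  assumes "lts I P \<mu> P'" and "inj \<pi>"
  shows "lts I (rename \<pi> P) (rename_act \<pi> \<mu>) (rename \<pi> P')"
  using assms
proof (induction rule: lts.induct)
  case (lts_HBang a x b P \<mu> P')
  then show ?case by (auto intro: lts.lts_HBang)
next
  case (lts_FBang h x P \<mu> P')
  then show ?case by (auto intro: lts.lts_FBang)
next
  case (lts_HComL P a v b P' Q Q')
  then show ?case by (auto intro: lts.lts_HComL)
next
  case (lts_HComR P a v b P' Q Q')
  then show ?case by (auto intro: lts.lts_HComR)
next
  case (lts_FComL P h v P' Q Q')
  then show ?case by (auto intro: lts.lts_FComL)
next
  case (lts_FComR P h v P' Q Q')
  then show ?case by (auto intro: lts.lts_FComR)
next
  case (lts_HNu P \<mu> P' a)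
  then show ?case by (auto intro!: lts.lts_HNu simp: inj_image_mem_iff)
next
  case (lts_CondT e v f P \<mu> P' Q)
  then show ?case by (simp add: lts.lts_CondT[of I e v] inj_image_disjoint_iff)
next
  case (lts_CondF e v f w Q \<mu> Q' P)
  then show ?case by (simp add: lts.lts_CondF[of I e v _ w] inj_image_disjoint_iff)
qed (simp_all add: lts.intros inj_eq inj_image_disjoint_iff)

section \<open>Alpha-conversion of restrictions\<close>

lemma HNu_eqD:
  assumes "HNu a P = HNu b Q"
  shows "P = rename (transpose a b) Q" and "a \<in> fn Q \<Longrightarrow> a = b"
proof -
  have "fn P - {a} = fn Q - {b}"
    using arg_cong[OF assms, of fn] by simp
  then have fresh: "a \<in> fn Q \<Longrightarrow> a = b"
    by blast
  then show "a \<in> fn Q \<Longrightarrow> a = b" .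
  show "P = rename (transpose a b) Q"
    using assms fresh
  proof (transfer, goal_cases)
    case (1 a r b s)
    \<comment> \<open>Opening the outermost index with \<open>a\<close> undoes the abstraction of
      \<open>a\<close>, because \<open>r\<close> has no dangling index that could be mistaken for
      it.\<close>
    have "trav (\<lambda>i m. if m = Bound i then Free a else m) keep keep 0 0 0
        (trav (abs_ref a) keep keep 0 0 0 r) = trav keep keep keep 0 0 0 r"
      unfolding trav_trav
    proof (rule trav_cong[OF 1(1)])
      show "(if abs_ref a i m = Bound i then Free a else abs_ref a i m) = m"
        if "lc_ref i m" for i m
        using that by (cases m) (auto simp: abs_ref_def)
    qed
    \<comment> \<open>The same opening turns \<open>b\<close> into \<open>a\<close> in
      \<open>s\<close>. The swap has the same effect, since \<open>a\<close> does not occur in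
      \<open>s\<close> unless it equals \<open>b\<close>.\<close>
    moreover have "trav (\<lambda>i m. if m = Bound i then Free a else m) keep keep 0 0 0
        (trav (abs_ref b) keep keep 0 0 0 s) = trav (\<lambda>_. map_ref (transpose a b)) keep keep 0 0 0 s"
      unfolding trav_trav
    proof (rule trav_cong[OF 1(2)])
      show "(if abs_ref b i m = Bound i then Free a else abs_ref b i m) = map_ref (transpose a b) m"
        if "lc_ref i m" "\<And>n. m = Free n \<Longrightarrow> n \<in> fn_raw s" for i m
        using that 1(4) by (cases m) (auto simp: abs_ref_def transpose_def)
    qed
    ultimately show ?case
      using 1(3) by (simp add: abs_h_def trav_keep)
  qed
qed

text \<open>The second disjunct admits the trivial swap, which users of \<open>HNu_eqD\<close>
  cannot rule out.\<close>

lemma HNu_alpha: "b \<notin> fn P \<or> a = b \<Longrightarrow> HNu b (rename (transpose a b) P) = HNu a P"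
proof (transfer, goal_cases)
  case (1 b r a)
  show ?case
    unfolding abs_h_def trav_trav raw.inject
  proof (rule trav_cong[OF 1(1)])
    show "abs_ref b i (map_ref (transpose a b) m) = abs_ref a i m"
      if "\<And>n. m = Free n \<Longrightarrow> n \<in> fn_raw r" for i m
      using that 1(2) by (cases m) (auto simp: abs_ref_def transpose_def)
  qed
qed

lemma HNu_neq [simp]:
  "HNu n X \<noteq> HIn a x b P" "HNu n X \<noteq> FIn h x P" "HNu n X \<noteq> HOut a e b P" "HNu n X \<noteq> FOut h e P"
  "HNu n X \<noteq> Succ w P" "HNu n X \<noteq> HBang a x b P" "HNu n X \<noteq> FBang h x P" "HNu n X \<noteq> Par P Q"
  "HNu n X \<noteq> FNu h P" "HNu n X \<noteq> Sum P Q" "HNu n X \<noteq> Cond e f P Q"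
  by (transfer, simp)+

lemma Par_neq [simp]:
  "Par X Y \<noteq> HIn a x b P" "Par X Y \<noteq> FIn h x P" "Par X Y \<noteq> HOut a e b P" "Par X Y \<noteq> FOut h e P"
  "Par X Y \<noteq> Succ w P" "Par X Y \<noteq> HBang a x b P" "Par X Y \<noteq> FBang h x P" "Par X Y \<noteq> HNu a P"
  "Par X Y \<noteq> FNu h P" "Par X Y \<noteq> Sum P Q" "Par X Y \<noteq> Cond e f P Q"
  by (transfer, simp)+

lemma Par_eq [simp]: "Par P Q = Par P' Q' \<longleftrightarrow> P = P' \<and> Q = Q'"
  by transfer simp

text \<open>The rule may have been applied to another representative \<open>b\<close> of the binder.
  Swapping \<open>a\<close> and \<open>b\<close> returns to the given one, and an action without
  higher-order names is unaffected.\<close>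

lemma lts_HNuE:
  assumes "lts I (HNu a P) \<mu> P'" and "hnames \<mu> = {}"
  obtains P'' where "lts I P \<mu> P''" and "P' = HNu a P''"
  using assms(1)
proof (cases rule: lts.cases)
  case (lts_HNu Q Q' b)
  let ?t = "transpose a b"
  have P: "P = rename ?t Q" and fresh: "a \<in> fn Q \<Longrightarrow> a = b"
    using HNu_eqD lts_HNu(1) by blast+
  have "rename_act ?t \<mu> = \<mu>"
    using assms(2) by (cases \<mu>) auto
  then have "lts I P \<mu> (rename ?t Q')"
    using lts_rename[OF lts_HNu(3), of ?t] P by simp
  moreover have "bn \<mu> = {}"
    using assms(2) by (cases \<mu>) auto
  then have "P' = HNu a (rename ?t Q')"
    using HNu_alpha[of a Q' b] lts_fn[OF lts_HNu(3)] fresh lts_HNu(2)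
    by (metis Un_empty_right subsetD transpose_commute)
  ultimately show ?thesis
    by (rule that)
qed auto

section \<open>Visibility typing over de Bruijn nodes\<close>

definition transitive :: "vis \<Rightarrow> bool" where
  "transitive \<Delta> \<longleftrightarrow> (\<forall>p a V W. \<Delta> p = Some V \<and> \<Delta> (Nm a) = Some W \<and> a \<in> V \<longrightarrow> W \<subseteq> V)"

primrec map_point :: "(nat \<Rightarrow> nat) \<Rightarrow> point \<Rightarrow> point" where
  "map_point f Cur = Cur"
| "map_point f (Nm n) = Nm (f n)"

lemma map_point_eq_Cur [simp]: "map_point f p = Cur \<longleftrightarrow> p = Cur"
  by (cases p) auto

fun shift :: "vis \<Rightarrow> vis" where
  "shift \<Delta> Cur = map_option (image Suc) (\<Delta> Cur)"
| "shift \<Delta> (Nm 0) = None"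
| "shift \<Delta> (Nm (Suc n)) = map_option (image Suc) (\<Delta> (Nm n))"

text \<open>
  \<open>input_vis \<Delta> V\<close> and \<open>output_vis \<Delta> V\<close> are the contexts of the continuations in the rules
  \<open>typed_HIn\<close> and \<open>typed_HOut\<close>, with the bound name as node 0.
\<close>

definition input_vis :: "vis \<Rightarrow> nat set \<Rightarrow> vis" where
  "input_vis \<Delta> V = (shift \<Delta>)(Cur \<mapsto> insert 0 (Suc ` V))"

definition output_vis :: "vis \<Rightarrow> nat set \<Rightarrow> vis" where
  "output_vis \<Delta> V = (shift \<Delta>)(Cur := None, Nm 0 \<mapsto> insert 0 (Suc ` V))"

text \<open>Forgetting node 0 in \<open>\<Delta>'\<close> yields a context that can be weakened to \<open>\<Delta>\<close>.\<close>

definition drop_le :: "vis \<Rightarrow> vis \<Rightarrow> bool" where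
  "drop_le \<Delta>' \<Delta> \<longleftrightarrow>
     (\<forall>p V'. \<Delta>' (map_point Suc p) = Some V' \<longrightarrow> (\<exists>V. \<Delta> p = Some V \<and> Suc -` V' \<subseteq> V)) \<and>
     (Cur \<in> dom \<Delta> \<longrightarrow> Cur \<in> dom \<Delta>')"

fun lift_env :: "(ref \<Rightarrow> nat) \<Rightarrow> ref \<Rightarrow> nat" where
  "lift_env \<eta> (Bound 0) = 0"
| "lift_env \<eta> (Bound (Suc i)) = Suc (\<eta> (Bound i))"
| "lift_env \<eta> (Free n) = Suc (\<eta> (Free n))"

text \<open>
  Since weakening is admissible, both components of a parallel composition may be given the whole
  context, except for \<open>Cur\<close>.
\<close>

primrec wt_raw :: "('f, 'v) raw \<Rightarrow> (ref \<Rightarrow> nat) \<Rightarrow> vis \<Rightarrow> bool" where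
  "wt_raw (RHIn a r) \<eta> \<Delta> \<longleftrightarrow> Cur \<notin> dom \<Delta> \<and>
     (\<exists>V. \<Delta> (Nm (\<eta> a)) = Some V \<and> wt_raw r (lift_env \<eta>) (input_vis \<Delta> V))"
| "wt_raw (RFIn h r) \<eta> \<Delta> \<longleftrightarrow> Cur \<in> dom \<Delta> \<and> wt_raw r \<eta> \<Delta>"
| "wt_raw (RHOut a e r) \<eta> \<Delta> \<longleftrightarrow>
     (\<exists>V. \<Delta> Cur = Some V \<and> \<eta> a \<in> V \<and> wt_raw r (lift_env \<eta>) (output_vis \<Delta> V))"
| "wt_raw (RFOut h e r) \<eta> \<Delta> \<longleftrightarrow> Cur \<notin> dom \<Delta> \<and> wt_raw r \<eta> \<Delta>"
| "wt_raw (RSucc w r) \<eta> \<Delta> \<longleftrightarrow> True"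
| "wt_raw (RHBang a r) \<eta> \<Delta> \<longleftrightarrow> Cur \<notin> dom \<Delta> \<and>
     (\<exists>V. \<Delta> (Nm (\<eta> a)) = Some V \<and> wt_raw r (lift_env \<eta>) (input_vis \<Delta> V))"
| "wt_raw (RFBang h r) \<eta> \<Delta> \<longleftrightarrow> False"
| "wt_raw (RPar r s) \<eta> \<Delta> \<longleftrightarrow>
     wt_raw r \<eta> \<Delta> \<and> wt_raw s \<eta> (\<Delta>(Cur := None)) \<or>
     wt_raw r \<eta> (\<Delta>(Cur := None)) \<and> wt_raw s \<eta> \<Delta>"
| "wt_raw (RHNu r) \<eta> \<Delta> \<longleftrightarrow>
     (\<exists>\<Delta>'. transitive \<Delta>' \<and> drop_le \<Delta>' \<Delta> \<and> wt_raw r (lift_env \<eta>) \<Delta>')"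
| "wt_raw (RFNu r) \<eta> \<Delta> \<longleftrightarrow> wt_raw r \<eta> \<Delta>"
| "wt_raw RNil \<eta> \<Delta> \<longleftrightarrow> Cur \<notin> dom \<Delta>"
| "wt_raw (RSum r s) \<eta> \<Delta> \<longleftrightarrow> wt_raw r \<eta> \<Delta> \<and> wt_raw s \<eta> \<Delta>"
| "wt_raw (RIf e f r s) \<eta> \<Delta> \<longleftrightarrow> wt_raw r \<eta> \<Delta> \<and> wt_raw s \<eta> \<Delta>"

section \<open>Transitivity of extended contexts\<close>

lemma transitiveD:
  "transitive \<Delta> \<Longrightarrow> \<Delta> p = Some V \<Longrightarrow> a \<in> V \<Longrightarrow> \<Delta> (Nm a) = Some W \<Longrightarrow> W \<subseteq> V"
  unfolding transitive_def by blast

lemma shift_SomeE: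
  assumes "shift \<Delta> p = Some V"
  obtains q W where "p = map_point Suc q" and "\<Delta> q = Some W" and "V = Suc ` W"
  using assms
proof (cases "(\<Delta>, p)" rule: shift.cases)
  case (1 \<Gamma>)
  then show ?thesis using that[of Cur] assms by auto
next
  case (3 \<Gamma> n)
  then show ?thesis using that[of "Nm n"] assms by auto
qed (use assms in auto)

lemma shift_Suc [simp]: "shift \<Delta> (map_point Suc p) = map_option (image Suc) (\<Delta> p)"
  by (cases p) auto

text \<open>\<open>V\<close> has to be the value of some point, so that transitivity of
  \<open>\<Delta>\<close> closes it. Node 0 has no value of its own here and imposes
  nothing.\<close>

lemma transitive_input_vis:
  assumes "transitive \<Delta>" and "\<Delta> p = Some V"
  shows "transitive (input_vis \<Delta> V)"
  unfolding transitive_def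
proof (intro allI impI, elim conjE)
  fix p a U W
  assume *: "input_vis \<Delta> V p = Some U" "input_vis \<Delta> V (Nm a) = Some W" "a \<in> U"
  then obtain n W' where a: "a = Suc n" "\<Delta> (Nm n) = Some W'" "W = Suc ` W'"
    by (cases a) (auto simp: input_vis_def)
  show "W \<subseteq> U"
  proof (cases p)
    case Cur
    then show ?thesis
      using * a transitiveD[OF assms(1), OF assms(2), of n W'] by (auto simp: input_vis_def)
  next
    case (Nm m)
    then show ?thesis
      using * a transitiveD[OF assms(1), of "Nm (m - 1)" _ n W']
      by (cases m) (auto simp: input_vis_def)
  qed
qed

text \<open>Only node 0 sees node 0, so its new value constrains no other point.\<close>

lemma transitive_output_vis:
  assumes "transitive \<Delta>" and "\<Delta> Cur = Some V"
  shows "transitive (output_vis \<Delta> V)"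
  unfolding transitive_def
proof (intro allI impI, elim conjE)
  fix p a U W
  assume *: "output_vis \<Delta> V p = Some U" "output_vis \<Delta> V (Nm a) = Some W" "a \<in> U"
  then obtain m where p: "p = Nm m"
    by (cases p) (auto simp: output_vis_def)
  show "W \<subseteq> U"
  proof (cases a)
    case 0
    then show ?thesis
      using * p by (cases m) (auto simp: output_vis_def)
  next
    case (Suc n)
    then obtain W' where a: "\<Delta> (Nm n) = Some W'" "W = Suc ` W'"
      using * by (auto simp: output_vis_def)
    show ?thesis
      using * a Suc p transitiveD[OF assms(1), of "Nm (m - 1)" _ n W']
        transitiveD[OF assms, of n W']
      by (cases m) (auto simp: output_vis_def)
  qed
qed

lemma transitive_drop_Cur: "transitive \<Delta> \<Longrightarrow> transitive (\<Delta>(Cur := None))"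
  unfolding transitive_def by (metis fun_upd_apply option.distinct(1))

section \<open>Renaming of nodes combined with weakening\<close>

text \<open>Values may grow and nodes may be added, but \<open>Cur\<close> may not: it is a token,
  not a resource to be weakened. The map \<open>f\<close> may merge nodes, which is needed when node
  0 is instantiated by an actual name.\<close>

definition embeds :: "(nat \<Rightarrow> nat) \<Rightarrow> vis \<Rightarrow> vis \<Rightarrow> bool" where
  "embeds f \<Delta> \<Delta>' \<longleftrightarrow>
     (\<forall>p V. \<Delta> p = Some V \<longrightarrow> (\<exists>V'. \<Delta>' (map_point f p) = Some V' \<and> f ` V \<subseteq> V')) \<and>
     (Cur \<in> dom \<Delta>' \<longrightarrow> Cur \<in> dom \<Delta>)"

definition lift_map :: "(nat \<Rightarrow> nat) \<Rightarrow> nat \<Rightarrow> nat" where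
  "lift_map f = case_nat 0 (\<lambda>n. Suc (f n))"

lemma lift_map_simps [simp]: "lift_map f 0 = 0" "lift_map f (Suc n) = Suc (f n)"
  by (auto simp: lift_map_def)

lemma lift_env_comp: "lift_env (f \<circ> \<eta>) = lift_map f \<circ> lift_env \<eta>"
proof
  fix m
  show "lift_env (f \<circ> \<eta>) m = (lift_map f \<circ> lift_env \<eta>) m"
    by (cases "(\<eta>, m)" rule: lift_env.cases) auto
qed

lemma embedsD:
  "embeds f \<Delta> \<Delta>' \<Longrightarrow> \<Delta> p = Some V \<Longrightarrow> \<exists>V'. \<Delta>' (map_point f p) = Some V' \<and> f ` V \<subseteq> V'"
  unfolding embeds_def by blast

lemma embeds_Cur: "embeds f \<Delta> \<Delta>' \<Longrightarrow> Cur \<in> dom \<Delta>' \<longleftrightarrow> Cur \<in> dom \<Delta>"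
  unfolding embeds_def by (metis domI domD map_point.simps(1))

lemma embeds_shift: 
  assumes "embeds f \<Delta> \<Delta>'"
  shows "embeds (lift_map f) (shift \<Delta>) (shift \<Delta>')"
  unfolding embeds_def
proof (intro conjI allI impI)
  fix p V
  assume "shift \<Delta> p = Some V"
  then obtain q W where q: "p = map_point Suc q" "\<Delta> q = Some W" "V = Suc ` W"
    by (rule shift_SomeE)
  obtain W' where "\<Delta>' (map_point f q) = Some W'" "f ` W \<subseteq> W'"
    using embedsD[OF assms q(2)] by blast
  moreover have "map_point (lift_map f) p = map_point Suc (map_point f q)"
    using q(1) by (cases q) auto
  ultimately show "\<exists>V'. shift \<Delta>' (map_point (lift_map f) p) = Some V' \<and> lift_map f ` V \<subseteq> V'"
    using q(3) by auto
next
  show "Cur \<in> dom (shift \<Delta>)" if "Cur \<in> dom (shift \<Delta>')"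
    using that embeds_Cur[OF assms] by (simp add: domIff)
qed

lemma embeds_input_vis:
  assumes "embeds f \<Delta> \<Delta>'" and "f ` V \<subseteq> V'"
  shows "embeds (lift_map f) (input_vis \<Delta> V) (input_vis \<Delta>' V')"
  unfolding embeds_def
proof (intro conjI allI impI)
  fix p U
  assume "input_vis \<Delta> V p = Some U"
  then show "\<exists>V''. input_vis \<Delta>' V' (map_point (lift_map f) p) = Some V'' \<and> lift_map f ` U \<subseteq> V''"
    using assms(2) embedsD[OF embeds_shift[OF assms(1)], of p U]
    by (cases p) (auto simp: input_vis_def)
qed (auto simp: input_vis_def)

lemma embeds_output_vis:
  assumes "embeds f \<Delta> \<Delta>'" and "f ` V \<subseteq> V'"
  shows "embeds (lift_map f) (output_vis \<Delta> V) (output_vis \<Delta>' V')"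
  unfolding embeds_def
proof (intro conjI allI impI)
  fix p U
  assume *: "output_vis \<Delta> V p = Some U"
  show "\<exists>V''. output_vis \<Delta>' V' (map_point (lift_map f) p) = Some V'' \<and> lift_map f ` U \<subseteq> V''"
  proof (cases "p = Nm 0")
    case True
    then show ?thesis
      using * assms(2) by (auto simp: output_vis_def)
  next
    case False
    then show ?thesis
      using * embedsD[OF embeds_shift[OF assms(1)], of p U]
      by (cases p; cases "case p of Nm n \<Rightarrow> n | Cur \<Rightarrow> 0") (auto simp: output_vis_def)
  qed
qed (auto simp: output_vis_def)

lemma embeds_drop_Cur: "embeds f \<Delta> \<Delta>' \<Longrightarrow> embeds f (\<Delta>(Cur := None)) (\<Delta>'(Cur := None))"
  unfolding embeds_def by auto

text \<open>
  The context \<open>\<Delta>2\<close> extends \<open>\<Delta>'\<close> by node 0, visible to the images of the points that see it in \<open>\<Delta>1\<close>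
  and to the points that transitivity then forces to see it.
\<close>

lemma embeds_drop_le:
  assumes emb: "embeds f \<Delta> \<Delta>'" and tr': "transitive \<Delta>'"
    and tr: "transitive \<Delta>1" and le: "drop_le \<Delta>1 \<Delta>"
  obtains \<Delta>2 where "transitive \<Delta>2" and "drop_le \<Delta>2 \<Delta>'" and "embeds (lift_map f) \<Delta>1 \<Delta>2"
proof -
  define Z where "Z = {map_point f p | p V. \<Delta>1 (map_point Suc p) = Some V \<and> 0 \<in> V}"
  define sees where "sees p V \<longleftrightarrow> p \<in> Z \<or> (\<exists>k \<in> V. Nm k \<in> Z)" for p V
  define W where "W = (case \<Delta>1 (Nm 0) of None \<Rightarrow> {} | Some U \<Rightarrow> f ` (Suc -` U))"
  \<comment> \<open>\<open>W\<close> need not be closed under visibility in the larger context.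
    Because \<open>\<Delta>'\<close> is transitive, one round of closure is enough.\<close>
  define W' where "W' = W \<union> \<Union> {U. \<exists>k \<in> W. \<Delta>' (Nm k) = Some U}"
  define \<Delta>2 where "\<Delta>2 p = (if p = Nm 0
      then if \<Delta>1 (Nm 0) = None then None else Some (insert 0 (Suc ` W'))
      else let q = map_point (\<lambda>n. n - 1) p in
        map_option (\<lambda>V. Suc ` V \<union> (if sees q V then {0} else {})) (\<Delta>' q))" for p
  have zero: "\<Delta>2 (Nm 0) = (if \<Delta>1 (Nm 0) = None then None else Some (insert 0 (Suc ` W')))"
    by (simp add: \<Delta>2_def)
  have suc: "\<Delta>2 (map_point Suc p) =
      map_option (\<lambda>V. Suc ` V \<union> (if sees p V then {0} else {})) (\<Delta>' p)" for p
    by (cases p) (auto simp: \<Delta>2_def Let_def)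
  have suc_Some: "\<exists>V. \<Delta>' p = Some V \<and> A = Suc ` V \<union> (if sees p V then {0} else {})"
    if "\<Delta>2 (map_point Suc p) = Some A" for p A
    using that unfolding suc by (cases "\<Delta>' p") auto
  have point: "p = Nm 0 \<or> (\<exists>q. p = map_point Suc q)" for p
    by (metis map_point.simps not0_implies_Suc point.exhaust)
  \<comment> \<open>If node 0 has a value, a point of \<open>Z\<close> already sees all of it: in
    \<open>\<Delta>1\<close> by transitivity, and hence in \<open>\<Delta>'\<close> along
    \<open>f\<close>. Letting such a point see node 0 adds no further obligation.\<close>
  have Z: "\<exists>V. \<Delta>' p = Some V \<and> (\<Delta>1 (Nm 0) \<noteq> None \<longrightarrow> W' \<subseteq> V)" if "p \<in> Z" for p
  proof -
    from that obtain q U where q: "p = map_point f q" "\<Delta>1 (map_point Suc q) = Some U" "0 \<in> U"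
      by (auto simp: Z_def)
    then obtain U' where U': "\<Delta> q = Some U'" "Suc -` U \<subseteq> U'"
      using le unfolding drop_le_def by blast
    then obtain V where V: "\<Delta>' p = Some V" "f ` U' \<subseteq> V"
      using embedsD[OF emb] q(1) by blast
    have "W' \<subseteq> V" if "\<Delta>1 (Nm 0) \<noteq> None"
    proof -
      from that obtain X where X: "\<Delta>1 (Nm 0) = Some X"
        by blast
      then have "X \<subseteq> U"
        using transitiveD[OF tr q(2,3)] by blast
      then have "W \<subseteq> V"
        using U' V X by (auto simp: W_def)
      then show ?thesis
        using transitiveD[OF tr' V(1)] by (fastforce simp: W'_def)
    qed
    then show ?thesis
      using V by blast
  qed
  have "transitive \<Delta>2"
    unfolding transitive_def
  proof (intro allI impI, elim conjE)
    fix p a A B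
    assume A: "\<Delta>2 p = Some A" and B: "\<Delta>2 (Nm a) = Some B" and a: "a \<in> A"
    show "B \<subseteq> A"
    proof (cases "p = Nm 0")
      case True
      then have A': "A = insert 0 (Suc ` W')" and ne: "\<Delta>1 (Nm 0) \<noteq> None"
        using A by (auto simp: zero split: if_splits)
      show ?thesis
      proof (cases a)
        case 0
        then show ?thesis using B A' ne by (simp add: zero)
      next
        case (Suc k)
        then have "k \<in> W'"
          using a A' by auto
        obtain V where V: "\<Delta>' (Nm k) = Some V"
            "B = Suc ` V \<union> (if sees (Nm k) V then {0} else {})"
          using B suc_Some[of "Nm k"] Suc by auto
        have "V \<subseteq> W'"
          using \<open>k \<in> W'\<close> V(1) transitiveD[OF tr'] unfolding W'_def by blast
        then show ?thesis using V(2) A' by (auto split: if_splits)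
      qed
    next
      case False
      then obtain q where q: "p = map_point Suc q"
        using point by blast
      then obtain V where V: "\<Delta>' q = Some V" "A = Suc ` V \<union> (if sees q V then {0} else {})"
        using A suc_Some[of q] by auto
      show ?thesis
      proof (cases a)
        case 0
        then have "sees q V"
          using a V(2) by (auto split: if_splits)
        have ne: "\<Delta>1 (Nm 0) \<noteq> None" and B': "B = insert 0 (Suc ` W')"
          using B 0 by (auto simp: zero split: if_splits)
        have "W' \<subseteq> V"
          using \<open>sees q V\<close> unfolding sees_def
        proof
          assume "q \<in> Z"
          then show ?thesis using Z V(1) ne by fastforce
        next
          assume "\<exists>k \<in> V. Nm k \<in> Z"
          then obtain k U where "k \<in> V" "\<Delta>' (Nm k) = Some U" "W' \<subseteq> U"
            using Z ne by blast
          then show ?thesis using transitiveD[OF tr' V(1)] by blast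
        qed
        then show ?thesis using B' V(2) \<open>sees q V\<close> by auto
      next
        case (Suc k)
        then have "k \<in> V"
          using a V(2) by (auto split: if_splits)
        obtain U where U: "\<Delta>' (Nm k) = Some U"
            "B = Suc ` U \<union> (if sees (Nm k) U then {0} else {})"
          using B suc_Some[of "Nm k"] Suc by auto
        have "U \<subseteq> V"
          using transitiveD[OF tr' V(1) \<open>k \<in> V\<close> U(1)] .
        moreover have "sees (Nm k) U \<Longrightarrow> sees q V"
          using \<open>U \<subseteq> V\<close> \<open>k \<in> V\<close> unfolding sees_def by blast
        ultimately show ?thesis using U(2) V(2) by auto
      qed
    qed
  qed
  moreover have "drop_le \<Delta>2 \<Delta>'"
    using suc[of Cur] unfolding drop_le_def by (auto simp: suc split: if_splits)
  moreover have "embeds (lift_map f) \<Delta>1 \<Delta>2"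
    unfolding embeds_def
  proof (intro conjI allI impI)
    fix p V
    assume V: "\<Delta>1 p = Some V"
    show "\<exists>V'. \<Delta>2 (map_point (lift_map f) p) = Some V' \<and> lift_map f ` V \<subseteq> V'"
    proof (cases "p = Nm 0")
      case True
      have "lift_map f n \<in> insert 0 (Suc ` W)" if "n \<in> V" for n
        using that V True by (cases n) (auto simp: W_def)
      then show ?thesis
        using V True by (auto simp: zero W'_def)
    next
      case False
      then obtain q where q: "p = map_point Suc q"
        using point by blast
      then obtain U where U: "\<Delta> q = Some U" "Suc -` V \<subseteq> U"
        using le V unfolding drop_le_def by blast
      then obtain U' where U': "\<Delta>' (map_point f q) = Some U'" "f ` U \<subseteq> U'"
        using embedsD[OF emb] by blast
      have "0 \<in> V \<Longrightarrow> sees (map_point f q) U'"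
        using V q by (auto simp: sees_def Z_def)
      then have "lift_map f n \<in> Suc ` U' \<union> (if sees (map_point f q) U' then {0} else {})"
        if "n \<in> V" for n
        using that U(2) U'(2) by (cases n) auto
      moreover have "map_point (lift_map f) p = map_point Suc (map_point f q)"
        using q by (cases q) auto
      ultimately show ?thesis
        using suc[of "map_point f q"] U'(1) by (simp add: image_subset_iff)
    qed
  next
    have "Cur \<in> dom \<Delta>1 \<longleftrightarrow> Cur \<in> dom \<Delta>"
      using le unfolding drop_le_def by (metis domD domI map_point.simps(1))
    then show "Cur \<in> dom \<Delta>2 \<Longrightarrow> Cur \<in> dom \<Delta>1"
      using embeds_Cur[OF emb] suc[of Cur] by (auto simp: domIff)
  qed
  ultimately show ?thesis
    by (rule that)
qed

text \<open>Weakening is admissible. The restriction case must extend \<open>\<Delta>'\<close> by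
  the hidden node, and \<open>embeds_drop_le\<close> does so by closing under
  \<open>\<Delta>'\<close>; hence the premise that \<open>\<Delta>'\<close> is transitive.\<close>

lemma wt_raw_embeds:
  "wt_raw r \<eta> \<Delta> \<Longrightarrow> embeds f \<Delta> \<Delta>' \<Longrightarrow> transitive \<Delta>' \<Longrightarrow> wt_raw r (f \<circ> \<eta>) \<Delta>'"
proof (induction r arbitrary: \<eta> \<Delta> f \<Delta>')
  case (RHIn a r)
  from RHIn.prems(1) obtain V where V: "\<Delta> (Nm (\<eta> a)) = Some V" "wt_raw r (lift_env \<eta>) (input_vis \<Delta> V)"
    by auto
  then obtain V' where V': "\<Delta>' (Nm (f (\<eta> a))) = Some V'" "f ` V \<subseteq> V'"
    using embedsD[OF RHIn.prems(2) V(1)] by auto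
  have "wt_raw r (lift_map f \<circ> lift_env \<eta>) (input_vis \<Delta>' V')"
    using RHIn.IH[OF V(2) embeds_input_vis[OF RHIn.prems(2) V'(2)]]
      transitive_input_vis[OF RHIn.prems(3) V'(1)] .
  then show ?case
    using RHIn.prems(1) V'(1) embeds_Cur[OF RHIn.prems(2)] 
    unfolding wt_raw.simps lift_env_comp unfolding o_apply by blast
next
  case (RHBang a r)
  from RHBang.prems(1) obtain V where V: "\<Delta> (Nm (\<eta> a)) = Some V" "wt_raw r (lift_env \<eta>) (input_vis \<Delta> V)"
    by auto
  then obtain V' where V': "\<Delta>' (Nm (f (\<eta> a))) = Some V'" "f ` V \<subseteq> V'"
    using embedsD[OF RHBang.prems(2) V(1)] by auto
  have "wt_raw r (lift_map f \<circ> lift_env \<eta>) (input_vis \<Delta>' V')"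
    using RHBang.IH[OF V(2) embeds_input_vis[OF RHBang.prems(2) V'(2)]]
      transitive_input_vis[OF RHBang.prems(3) V'(1)] .
  then show ?case
    using RHBang.prems(1) V'(1) embeds_Cur[OF RHBang.prems(2)] 
    unfolding wt_raw.simps lift_env_comp unfolding o_apply by blast
next
  case (RHOut a e r)
  from RHOut.prems(1) obtain V where V: "\<Delta> Cur = Some V" "\<eta> a \<in> V" "wt_raw r (lift_env \<eta>) (output_vis \<Delta> V)"
    by auto
  then obtain V' where V': "\<Delta>' Cur = Some V'" "f ` V \<subseteq> V'"
    using embedsD[OF RHOut.prems(2) V(1)] by auto
  have "wt_raw r (lift_map f \<circ> lift_env \<eta>) (output_vis \<Delta>' V')"
    using RHOut.IH[OF V(3) embeds_output_vis[OF RHOut.prems(2) V'(2)]]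
      transitive_output_vis[OF RHOut.prems(3) V'(1)] .
  then show ?case
    using V(2) V' 
    unfolding wt_raw.simps lift_env_comp unfolding o_apply by blast
next
  case (RPar r s)
  note here = RPar.IH[OF _ RPar.prems(2,3)]
  note noCur = RPar.IH[OF _ embeds_drop_Cur[OF RPar.prems(2)] transitive_drop_Cur[OF RPar.prems(3)]]
  show ?case
    using RPar.prems(1) here noCur unfolding wt_raw.simps by blast
next
  case (RHNu r)
  from RHNu.prems(1) obtain \<Delta>1 where \<Delta>1: "transitive \<Delta>1" "drop_le \<Delta>1 \<Delta>" "wt_raw r (lift_env \<eta>) \<Delta>1"
    by auto
  obtain \<Delta>2 where \<Delta>2: "transitive \<Delta>2" "drop_le \<Delta>2 \<Delta>'" "embeds (lift_map f) \<Delta>1 \<Delta>2"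
    using embeds_drop_le[OF RHNu.prems(2,3) \<Delta>1(1,2)] .
  show ?case
    using RHNu.IH[OF \<Delta>1(3) \<Delta>2(3,1)] \<Delta>2(1,2) 
    unfolding wt_raw.simps lift_env_comp unfolding o_apply by blast
next
  case (RFIn h r)
  then show ?case using embeds_Cur[OF RFIn.prems(2)] unfolding wt_raw.simps by blast
next
  case (RFOut h e r)
  then show ?case using embeds_Cur[OF RFOut.prems(2)] unfolding wt_raw.simps by blast
next
  case RNil
  then show ?case using embeds_Cur[OF RNil(2)] by auto
next
  case (RFNu r)
  then show ?case unfolding wt_raw.simps by blast
next
  case (RSum r s)
  then show ?case unfolding wt_raw.simps by blast
next
  case (RIf e f r s)
  then show ?case unfolding wt_raw.simps by blast
qed simp_all

section \<open>Typing of traversed terms\<close>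

text \<open>Typing reads higher-order names only through the environment, so a traversal amounts to
  a change of environment as long as \<open>H\<close> commutes with passing a binder.
  \<open>X\<close> bounds the free names: \<open>UNIV\<close> serves abstraction,
  \<open>fn_raw r\<close> serves congruence.\<close>

lemma wt_raw_trav:
  assumes H: "\<And>i \<eta> \<eta>' m. (\<And>m. lc_ref i m \<Longrightarrow> m \<notin> Free ` (- X) \<Longrightarrow> \<eta> (H i m) = \<eta>' m) \<Longrightarrow>
      lc_ref (Suc i) m \<Longrightarrow> m \<notin> Free ` (- X) \<Longrightarrow> lift_env \<eta> (H (Suc i) m) = lift_env \<eta>' m"
  shows "lc i j k r \<Longrightarrow> fn_raw r \<subseteq> X \<Longrightarrow>
    (\<And>m. lc_ref i m \<Longrightarrow> m \<notin> Free ` (- X) \<Longrightarrow> \<eta> (H i m) = \<eta>' m) \<Longrightarrow>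
    wt_raw (trav H F E i j k r) \<eta> \<Delta> = wt_raw r \<eta>' \<Delta>"
proof (induction r arbitrary: i j k \<eta> \<eta>' \<Delta>)
  case (RHIn a r)
  have "\<eta> (H i a) = \<eta>' a"
    by (rule RHIn.prems(3)) (use RHIn.prems(1,2) in auto)
  moreover have "wt_raw (trav H F E (Suc i) j (Suc k) r) (lift_env \<eta>) \<Delta> = wt_raw r (lift_env \<eta>') \<Delta>" for \<Delta>
    by (rule RHIn.IH; (rule H[of i \<eta> \<eta>', OF RHIn.prems(3)])?) (use RHIn.prems(1,2) in auto)
  ultimately show ?case
    by simp
next
  case (RHBang a r)
  have "\<eta> (H i a) = \<eta>' a"
    by (rule RHBang.prems(3)) (use RHBang.prems(1,2) in auto)
  moreover have "wt_raw (trav H F E (Suc i) j (Suc k) r) (lift_env \<eta>) \<Delta> = wt_raw r (lift_env \<eta>') \<Delta>" for \<Delta>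
    by (rule RHBang.IH; (rule H[of i \<eta> \<eta>', OF RHBang.prems(3)])?) (use RHBang.prems(1,2) in auto)
  ultimately show ?case
    by simp
next
  case (RHOut a e r)
  have "\<eta> (H i a) = \<eta>' a"
    by (rule RHOut.prems(3)) (use RHOut.prems(1,2) in auto)
  moreover have "wt_raw (trav H F E (Suc i) j k r) (lift_env \<eta>) \<Delta> = wt_raw r (lift_env \<eta>') \<Delta>" for \<Delta>
    by (rule RHOut.IH; (rule H[of i \<eta> \<eta>', OF RHOut.prems(3)])?) (use RHOut.prems(1,2) in auto)
  ultimately show ?case
    by simp
next
  case (RHNu r)
  have "wt_raw (trav H F E (Suc i) j k r) (lift_env \<eta>) \<Delta> = wt_raw r (lift_env \<eta>') \<Delta>" for \<Delta>
    by (rule RHNu.IH; (rule H[of i \<eta> \<eta>', OF RHNu.prems(3)])?) (use RHNu.prems(1,2) in auto)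
  then show ?case
    by simp
next
  case (RPar r s)
  have "wt_raw (trav H F E i j k r) \<eta> \<Delta> = wt_raw r \<eta>' \<Delta>" for \<Delta>
    by (rule RPar.IH; (rule RPar.prems(3))?) (use RPar.prems(1,2) in auto)
  moreover have "wt_raw (trav H F E i j k s) \<eta> \<Delta> = wt_raw s \<eta>' \<Delta>" for \<Delta>
    by (rule RPar.IH; (rule RPar.prems(3))?) (use RPar.prems(1,2) in auto)
  ultimately show ?case
    by simp
next
  case (RSum r s)
  have "wt_raw (trav H F E i j k r) \<eta> \<Delta> = wt_raw r \<eta>' \<Delta>" for \<Delta>
    by (rule RSum.IH; (rule RSum.prems(3))?) (use RSum.prems(1,2) in auto)
  moreover have "wt_raw (trav H F E i j k s) \<eta> \<Delta> = wt_raw s \<eta>' \<Delta>" for \<Delta>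
    by (rule RSum.IH; (rule RSum.prems(3))?) (use RSum.prems(1,2) in auto)
  ultimately show ?case
    by simp
next
  case (RIf e f r s)
  have "wt_raw (trav H F E i j k r) \<eta> \<Delta> = wt_raw r \<eta>' \<Delta>" for \<Delta>
    by (rule RIf.IH; (rule RIf.prems(3))?) (use RIf.prems(1,2) in auto)
  moreover have "wt_raw (trav H F E i j k s) \<eta> \<Delta> = wt_raw s \<eta>' \<Delta>" for \<Delta>
    by (rule RIf.IH; (rule RIf.prems(3))?) (use RIf.prems(1,2) in auto)
  ultimately show ?case
    by simp
next
  case (RFIn h r)
  have "wt_raw (trav H F E i j (Suc k) r) \<eta> \<Delta> = wt_raw r \<eta>' \<Delta>" for \<Delta>
    by (rule RFIn.IH; (rule RFIn.prems(3))?) (use RFIn.prems(1,2) in auto)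
  then show ?case
    by simp
next
  case (RFOut h e r)
  have "wt_raw (trav H F E i j k r) \<eta> \<Delta> = wt_raw r \<eta>' \<Delta>" for \<Delta>
    by (rule RFOut.IH; (rule RFOut.prems(3))?) (use RFOut.prems(1,2) in auto)
  then show ?case
    by simp
next
  case (RFNu r)
  have "wt_raw (trav H F E i (Suc j) k r) \<eta> \<Delta> = wt_raw r \<eta>' \<Delta>" for \<Delta>
    by (rule RFNu.IH; (rule RFNu.prems(3))?) (use RFNu.prems(1,2) in auto)
  then show ?case
    by simp
qed simp_all

lemma lift_env_abs_ref:
  assumes "\<And>m. lc_ref i m \<Longrightarrow> \<eta> (abs_ref b i m) = \<eta>' m" and "lc_ref (Suc i) m"
  shows "lift_env \<eta> (abs_ref b (Suc i) m) = lift_env \<eta>' m"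
proof (cases "(\<eta>, m)" rule: lift_env.cases)
  case (2 \<eta>0 l)
  then show ?thesis using assms(1)[of "Bound l"] assms(2) by (auto simp: abs_ref_def)
next
  case (3 \<eta>0 n)
  then show ?thesis using assms(1)[of "Free n"] by (auto simp: abs_ref_def split: if_splits)
qed (auto simp: abs_ref_def)

lemma wt_raw_trav_keep:
  assumes "lc 0 0 0 r" and "\<And>m. lc_ref 0 m \<Longrightarrow> m \<notin> Free ` (- fn_raw r) \<Longrightarrow> \<eta> m = \<eta>' m"
  shows "wt_raw (trav keep F E 0 0 0 r) \<eta> \<Delta> = wt_raw r \<eta>' \<Delta>"
proof (rule wt_raw_trav[where X = "fn_raw r"])
  fix i m and \<eta> \<eta>' :: "ref \<Rightarrow> nat"
  assume *: "\<And>m. lc_ref i m \<Longrightarrow> m \<notin> Free ` (- fn_raw r) \<Longrightarrow> \<eta> m = \<eta>' m"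
    "lc_ref (Suc i) m" "m \<notin> Free ` (- fn_raw r)"
  show "lift_env \<eta> m = lift_env \<eta>' m"
  proof (cases "(\<eta>, m)" rule: lift_env.cases)
    case (2 \<eta>0 l)
    then show ?thesis using *(1)[of "Bound l"] *(2,3) by auto
  next
    case (3 \<eta>0 n)
    then show ?thesis using *(1)[of "Free n"] *(2,3) by auto
  qed auto
qed (use assms in auto)

text \<open>The value at \<open>Bound i\<close> is a dummy, as processes have no dangling
  indices.\<close>

primrec env :: "(hname \<Rightarrow> nat) \<Rightarrow> ref \<Rightarrow> nat" where
  "env \<sigma> (Free n) = \<sigma> n"
| "env \<sigma> (Bound i) = 0"

definition bind_env :: "(hname \<Rightarrow> nat) \<Rightarrow> hname \<Rightarrow> hname \<Rightarrow> nat" where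
  "bind_env \<sigma> b n = (if n = b then 0 else Suc (\<sigma> n))"

lemma wt_raw_trav_abs:
  assumes "lc 0 0 0 r"
  shows "wt_raw (trav (abs_ref b) F E 0 0 0 r) (lift_env (env \<sigma>)) \<Delta> = wt_raw r (env (bind_env \<sigma> b)) \<Delta>"
proof (rule wt_raw_trav[where X = UNIV, OF _ assms])
  show "lift_env (env \<sigma>) (abs_ref b 0 m) = env (bind_env \<sigma> b) m" if "lc_ref 0 m" for m
    using that by (cases m) (auto simp: abs_ref_def bind_env_def)
qed (use lift_env_abs_ref in auto)

section \<open>Node typing of processes\<close>

lift_definition wt :: "('f, 'v) proc \<Rightarrow> (hname \<Rightarrow> nat) \<Rightarrow> vis \<Rightarrow> bool"
  is "\<lambda>r \<sigma>. wt_raw r (env \<sigma>)" .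

lemma wt_HIn: "wt (HIn a x b P) \<sigma> \<Delta> \<longleftrightarrow> Cur \<notin> dom \<Delta> \<and>
    (\<exists>V. \<Delta> (Nm (\<sigma> a)) = Some V \<and> wt P (bind_env \<sigma> b) (input_vis \<Delta> V))"
  by transfer (simp add: abs_hv_def wt_raw_trav_abs)

lemma wt_HBang: "wt (HBang a x b P) \<sigma> \<Delta> \<longleftrightarrow> wt (HIn a x b P) \<sigma> \<Delta>"
  by transfer simp

lemma wt_HOut: "wt (HOut a e b P) \<sigma> \<Delta> \<longleftrightarrow>
    (\<exists>V. \<Delta> Cur = Some V \<and> \<sigma> a \<in> V \<and> wt P (bind_env \<sigma> b) (output_vis \<Delta> V))"
  by transfer (simp add: abs_h_def wt_raw_trav_abs)

lemma wt_HNu: "wt (HNu a P) \<sigma> \<Delta> \<longleftrightarrow>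
    (\<exists>\<Delta>'. transitive \<Delta>' \<and> drop_le \<Delta>' \<Delta> \<and> wt P (bind_env \<sigma> a) \<Delta>')"
  by transfer (simp add: abs_h_def wt_raw_trav_abs)

lemma wt_FIn: "wt (FIn h x P) \<sigma> \<Delta> \<longleftrightarrow> Cur \<in> dom \<Delta> \<and> wt P \<sigma> \<Delta>"
  by transfer (simp add: abs_v_def wt_raw_trav_keep)

lemma wt_FOut: "wt (FOut h e P) \<sigma> \<Delta> \<longleftrightarrow> Cur \<notin> dom \<Delta> \<and> wt P \<sigma> \<Delta>"
  by transfer simp

text \<open>\<open>typed_FIn\<close> demands \<open>Cur\<close> and \<open>typed_FBang\<close>
  forbids it, so no replicated first-order input is typable by \<open>typed\<close> either.\<close>

lemma wt_FBang: "\<not> wt (FBang h x P) \<sigma> \<Delta>"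
  by transfer simp

lemma wt_Succ: "wt (Succ w P) \<sigma> \<Delta>"
  by (simp add: wt.rep_eq Succ.rep_eq)

lemma wt_Par: "wt (Par P Q) \<sigma> \<Delta> \<longleftrightarrow>
    wt P \<sigma> \<Delta> \<and> wt Q \<sigma> (\<Delta>(Cur := None)) \<or> wt P \<sigma> (\<Delta>(Cur := None)) \<and> wt Q \<sigma> \<Delta>"
  by transfer simp

lemma wt_FNu: "wt (FNu h P) \<sigma> \<Delta> \<longleftrightarrow> wt P \<sigma> \<Delta>"
  by transfer (simp add: abs_f_def wt_raw_trav_keep)

lemma wt_PNil: "wt PNil \<sigma> \<Delta> \<longleftrightarrow> Cur \<notin> dom \<Delta>"
  by transfer simp

lemma wt_Sum: "wt (Sum P Q) \<sigma> \<Delta> \<longleftrightarrow> wt P \<sigma> \<Delta> \<and> wt Q \<sigma> \<Delta>"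
  by transfer simp

lemma wt_Cond: "wt (Cond e f P Q) \<sigma> \<Delta> \<longleftrightarrow> wt P \<sigma> \<Delta> \<and> wt Q \<sigma> \<Delta>"
  by transfer simp

lemma wt_subst: "wt (subst P x v) \<sigma> \<Delta> \<longleftrightarrow> wt P \<sigma> \<Delta>"
  by transfer (simp add: subst_raw_def wt_raw_trav_keep)

lemmas wt_simps = wt_HIn wt_HBang wt_HOut wt_HNu wt_FIn wt_FOut wt_FBang wt_Succ wt_Par wt_FNu
  wt_PNil wt_Sum wt_Cond wt_subst

lemma wt_cong:
  assumes "\<And>n. n \<in> fn P \<Longrightarrow> \<sigma> n = \<sigma>' n"
  shows "wt P \<sigma> \<Delta> \<longleftrightarrow> wt P \<sigma>' \<Delta>"
  using assms
proof (transfer, goal_cases)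
  case (1 r \<sigma> \<sigma>' \<Delta>)
  have "env \<sigma> m = env \<sigma>' m" if "m \<notin> Free ` (- fn_raw r)" for m
    using that 1(2) by (cases m) auto
  then show ?case
    using wt_raw_trav_keep[OF 1(1), of "env \<sigma>" "env \<sigma>'" keep keep \<Delta>] by (simp add: trav_keep)
qed

lemma wt_embeds:
  assumes "wt P \<sigma> \<Delta>" and "embeds f \<Delta> \<Delta>'" and "transitive \<Delta>'"
    and \<sigma>': "\<And>n. n \<in> fn P \<Longrightarrow> \<sigma>' n = f (\<sigma> n)"
  shows "wt P \<sigma>' \<Delta>'"
proof -
  have "wt P (f \<circ> \<sigma>) \<Delta>'"
    using assms(1-3)
  proof (transfer, goal_cases)
    case (1 r \<sigma> \<Delta> f \<Delta>')
    have "(f \<circ> env \<sigma>) m = env (f \<circ> \<sigma>) m" if "lc_ref 0 m" for m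
      using that by (cases m) auto
    then show ?case
      using wt_raw_embeds[OF 1(2-4)] wt_raw_trav_keep[OF 1(1), of "f \<circ> env \<sigma>" "env (f \<circ> \<sigma>)" keep keep \<Delta>']
      by (simp add: trav_keep)
  qed
  then show ?thesis
    using wt_cong[of P "f \<circ> \<sigma>" \<sigma>'] \<sigma>' by simp
qed

text \<open>The least context into which \<open>\<Delta>\<close> embeds along an injective
  \<open>f\<close>. Minimality matters because \<open>drop_le\<close> bounds the context under a
  restriction from above.\<close>

definition image_vis :: "(nat \<Rightarrow> nat) \<Rightarrow> vis \<Rightarrow> vis" where
  "image_vis f \<Delta> p = (if p \<in> range (map_point f)
     then map_option (image f) (\<Delta> (map_point (inv f) p)) else None)"

lemma image_vis_map_point:
  assumes "inj f"
  shows "image_vis f \<Delta> (map_point f p) = map_option (image f) (\<Delta> p)"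
  by (cases p) (auto simp: image_vis_def assms intro: range_eqI[of _ _ "Nm _"] range_eqI[of _ _ Cur])

lemma image_vis_SomeE:
  assumes "inj f" and "image_vis f \<Delta> p = Some V"
  obtains q W where "p = map_point f q" and "\<Delta> q = Some W" and "V = f ` W"
proof -
  obtain q where q: "p = map_point f q"
    using assms(2) by (auto simp: image_vis_def split: if_splits)
  then show ?thesis
    using assms(2) that image_vis_map_point[OF assms(1), of \<Delta> q] by auto
qed

lemma embeds_image_vis:
  assumes "inj f"
  shows "embeds f \<Delta> (image_vis f \<Delta>)"
  using image_vis_map_point[OF assms, of \<Delta>] image_vis_map_point[OF assms, of \<Delta> Cur]
  unfolding embeds_def by (auto simp: domIff)

lemma transitive_image_vis:
  assumes "inj f" and "transitive \<Delta>"
  shows "transitive (image_vis f \<Delta>)"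
  unfolding transitive_def
proof (intro allI impI, elim conjE)
  fix p a V W
  assume *: "image_vis f \<Delta> p = Some V" "image_vis f \<Delta> (Nm a) = Some W" "a \<in> V"
  obtain q V' where q: "\<Delta> q = Some V'" "V = f ` V'"
    using image_vis_SomeE[OF assms(1) *(1)] by blast
  obtain n where n: "n \<in> V'" "a = f n"
    using * q by auto
  obtain W' where W': "\<Delta> (Nm n) = Some W'" "W = f ` W'"
    using *(2) n(2) image_vis_map_point[OF assms(1), of \<Delta> "Nm n"] by (cases "\<Delta> (Nm n)") auto
  show "W \<subseteq> V"
    using transitiveD[OF assms(2) q(1) n(1) W'(1)] q(2) W'(2) by blast
qed

section \<open>From visibility typing to node typing\<close>

lemma visibility_transitive: "visibility \<Delta> \<Longrightarrow> transitive \<Delta>"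
  unfolding visibility_def transitive_def by blast

lemma visibility_erase:
  assumes "visibility \<Delta>"
  shows "visibility (erase \<Delta> p)"
proof -
  have erase: "\<exists>W. \<Delta> q = Some W \<and> V = {a \<in> W. Nm a \<noteq> p} \<and> q \<noteq> p" if "erase \<Delta> p q = Some V" for q V
    using that by (auto simp: erase_def split: if_splits)
  have "dom (erase \<Delta> p) \<subseteq> dom \<Delta>"
    using erase by blast
  then have "finite (dom (erase \<Delta> p))"
    using assms finite_subset unfolding visibility_def by blast
  moreover have "finite V" if V: "V \<in> ran (erase \<Delta> p)" for V
  proof -
    obtain q W where "\<Delta> q = Some W" "V \<subseteq> W"
      using V erase unfolding ran_def by blast
    then show ?thesis
      using assms finite_subset ranI unfolding visibility_def by metis
  qed
  moreover have "transitive (erase \<Delta> p)"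
    unfolding transitive_def
  proof (intro allI impI, elim conjE)
    fix q a V W
    assume *: "erase \<Delta> p q = Some V" "erase \<Delta> p (Nm a) = Some W" "a \<in> V"
    obtain V' W' where V': "\<Delta> q = Some V'" "V = {a \<in> V'. Nm a \<noteq> p}"
        and W': "\<Delta> (Nm a) = Some W'" "W = {a \<in> W'. Nm a \<noteq> p}"
      using erase[OF *(1)] erase[OF *(2)] by blast
    have "W' \<subseteq> V'"
      using transitiveD[OF visibility_transitive[OF assms] V'(1) _ W'(1)] *(3) V'(2) by blast
    then show "W \<subseteq> V"
      using V'(2) W'(2) by blast
  qed
  ultimately show ?thesis
    unfolding visibility_def transitive_def by blast
qed

lemma typed_visibility: "typed \<Delta> P \<Longrightarrow> visibility \<Delta>"
  by (induction rule: typed.induct) (auto intro: visibility_erase)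

text \<open>A name that is fresh for \<open>\<Delta>\<close> is neither a point nor visible, so on
  all of \<open>\<Delta>\<close> binding it acts as a plain shift.\<close>

lemma embeds_bind_env:
  assumes "b \<notin> vis_names \<Delta>" and "\<Delta> p = Some V"
  shows "\<exists>V'. shift \<Delta> (map_point (bind_env id b) p) = Some V' \<and> bind_env id b ` V \<subseteq> V'"
proof -
  have "b \<notin> V" "p \<noteq> Nm b"
    using assms by (auto simp: vis_names_def ran_def)
  then have "bind_env id b ` V = Suc ` V" "map_point (bind_env id b) p = map_point Suc p"
    by (force simp: bind_env_def image_def, cases p, auto simp: bind_env_def)
  then show ?thesis
    using assms(2) by simp
qed

text \<open>At top level names serve as their own nodes, hence \<open>id\<close>. In each binder
  case the premise's context is carried over with the bound name as node 0, and for parallel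
  composition the parts are weakened to the whole.\<close>

lemma typed_wt: "typed \<Delta> P \<Longrightarrow> wt P id \<Delta>"
proof (induction rule: typed.induct)
  case (typed_HOut \<Delta> V a b P e)
  let ?f = "bind_env id b"
  have fresh: "n \<in> V \<Longrightarrow> n \<noteq> b" for n
    using typed_HOut by (auto simp: vis_names_def ran_def)
  have "embeds ?f ((erase \<Delta> Cur)(Nm b \<mapsto> V \<union> {b})) (output_vis \<Delta> V)"
    unfolding embeds_def
  proof (intro conjI allI impI)
    fix p U
    assume U: "((erase \<Delta> Cur)(Nm b \<mapsto> V \<union> {b})) p = Some U"
    show "\<exists>U'. output_vis \<Delta> V (map_point ?f p) = Some U' \<and> ?f ` U \<subseteq> U'"
    proof (cases "p = Nm b")
      case True
      then show ?thesis
        using U fresh by (auto simp: output_vis_def bind_env_def)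
    next
      case False
      \<comment> \<open>Erasing \<open>Cur\<close> changes no other value, since values contain only
        names.\<close>
      then have "\<Delta> p = Some U" "p \<noteq> Cur"
        using U by (auto simp: erase_def split: if_splits)
      then show ?thesis
        using False embeds_bind_env[OF typed_HOut.hyps(4), of p U]
        by (cases p) (auto simp: output_vis_def bind_env_def)
    qed
  qed (auto simp: output_vis_def)
  then have "wt P ?f (output_vis \<Delta> V)"
    by (rule wt_embeds[OF typed_HOut.IH])
      (use typed_HOut.hyps transitive_output_vis visibility_transitive in auto)
  then show ?case
    using typed_HOut.hyps unfolding wt_HOut by auto
next
  case (typed_HIn \<Delta> a V b P x)
  let ?f = "bind_env id b"
  have fresh: "n \<in> V \<Longrightarrow> n \<noteq> b" for n
    using typed_HIn by (auto simp: vis_names_def ran_def)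
  have "embeds ?f (\<Delta>(Cur \<mapsto> V \<union> {b})) (input_vis \<Delta> V)"
    unfolding embeds_def
  proof (intro conjI allI impI)
    fix p U
    assume U: "(\<Delta>(Cur \<mapsto> V \<union> {b})) p = Some U"
    show "\<exists>U'. input_vis \<Delta> V (map_point ?f p) = Some U' \<and> ?f ` U \<subseteq> U'"
    proof (cases "p = Cur")
      case True
      then show ?thesis
        using U fresh by (auto simp: input_vis_def bind_env_def)
    next
      case False
      then show ?thesis
        using U embeds_bind_env[OF typed_HIn.hyps(4), of p U]
        by (auto simp: input_vis_def)
    qed
  qed auto
  then have "wt P ?f (input_vis \<Delta> V)"
    by (rule wt_embeds[OF typed_HIn.IH])
      (use typed_HIn.hyps transitive_input_vis visibility_transitive in auto)
  then show ?case
    using typed_HIn.hyps unfolding wt_HIn by auto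
next
  case (typed_HNu \<Delta> P a)
  let ?f = "bind_env id a"
  have f: "inj ?f"
    by (auto simp: bind_env_def inj_def split: if_splits)
  have tr: "transitive (image_vis ?f \<Delta>)"
    using transitive_image_vis[OF f] typed_visibility[OF typed_HNu.hyps] visibility_transitive by blast
  \<comment> \<open>Under \<open>?f\<close> the name \<open>a\<close> is node 0, so forgetting that
    node is the same as erasing \<open>a\<close>.\<close>
  have "drop_le (image_vis ?f \<Delta>) (erase \<Delta> (Nm a))"
    unfolding drop_le_def
  proof (intro conjI allI impI)
    fix p V'
    assume "image_vis ?f \<Delta> (map_point Suc p) = Some V'"
    then obtain q W where q: "map_point Suc p = map_point ?f q" "\<Delta> q = Some W" "V' = ?f ` W"
      using image_vis_SomeE[OF f] by metis
    then have "q = p" "p \<noteq> Nm a"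
      by (cases p; cases q; auto simp: bind_env_def split: if_splits)+
    then show "\<exists>V. erase \<Delta> (Nm a) p = Some V \<and> Suc -` V' \<subseteq> V"
      using q by (auto simp: erase_def bind_env_def split: if_splits)
  next
    assume "Cur \<in> dom (erase \<Delta> (Nm a))"
    then show "Cur \<in> dom (image_vis ?f \<Delta>)"
      using image_vis_map_point[OF f, of \<Delta> Cur] by (auto simp: erase_def)
  qed
  moreover have "wt P ?f (image_vis ?f \<Delta>)"
    by (rule wt_embeds[OF typed_HNu.IH embeds_image_vis[OF f] tr]) simp
  ultimately show ?case
    using tr unfolding wt_HNu by blast
next
  case (typed_Par \<Delta> \<Delta>1 \<Delta>2 P1 P2)
  have un: "vis_un \<Delta>1 \<Delta>2 = \<Delta>" and Cur: "Cur \<notin> dom \<Delta>1 \<inter> dom \<Delta>2"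
    using typed_Par.hyps by (auto simp: split_def)
  have tr: "transitive \<Delta>" "transitive (\<Delta>(Cur := None))"
    using typed_Par.hyps(1) visibility_transitive transitive_drop_Cur by blast+
  have le: "\<Delta>1 p = Some V \<Longrightarrow> \<exists>V'. \<Delta> p = Some V' \<and> V \<subseteq> V'"
       "\<Delta>2 p = Some V \<Longrightarrow> \<exists>V'. \<Delta> p = Some V' \<and> V \<subseteq> V'" for p V
    unfolding un[symmetric] by (auto simp: vis_un_def split: option.splits)
  have id: "map_point id p = p" for p
    by (cases p) auto
  have emb: "embeds id \<Delta>0 \<Delta>" if "\<And>p V. \<Delta>0 p = Some V \<Longrightarrow> \<exists>V'. \<Delta> p = Some V' \<and> V \<subseteq> V'"
      "Cur \<in> dom \<Delta>0 \<or> Cur \<notin> dom \<Delta>" for \<Delta>0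
    using that unfolding embeds_def id by auto
  have emb': "embeds id \<Delta>0 (\<Delta>(Cur := None))" if "\<And>p V. \<Delta>0 p = Some V \<Longrightarrow> \<exists>V'. \<Delta> p = Some V' \<and> V \<subseteq> V'"
      "Cur \<notin> dom \<Delta>0" for \<Delta>0
    using that unfolding embeds_def id by auto
  show ?case
  proof (cases "Cur \<in> dom \<Delta>1")
    case True
    then have "Cur \<notin> dom \<Delta>2"
      using Cur by blast
    then have "wt P1 id \<Delta>" "wt P2 id (\<Delta>(Cur := None))"
      using wt_embeds[OF typed_Par.IH(1) emb tr(1)] wt_embeds[OF typed_Par.IH(2) emb' tr(2)] le True
      by auto
    then show ?thesis unfolding wt_Par by blast
  next
    case False
    then have "Cur \<in> dom \<Delta>2 \<or> Cur \<notin> dom \<Delta>"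
      unfolding un[symmetric] by (auto simp: vis_un_def split: option.splits)
    then have "wt P1 id (\<Delta>(Cur := None))" "wt P2 id \<Delta>"
      using wt_embeds[OF typed_Par.IH(1) emb' tr(2)] wt_embeds[OF typed_Par.IH(2) emb tr(1)] le False
      by auto
    then show ?thesis unfolding wt_Par by blast
  qed
qed (auto simp: wt_simps)

section \<open>Subject reduction\<close>

text \<open>
  For an input at a higher-order name nothing is claimed when \<open>Cur\<close> is present: the input may then
  create a second current thread.
\<close>

fun wt_after :: "'v act \<Rightarrow> (hname \<Rightarrow> nat) \<Rightarrow> vis \<Rightarrow> ('f, 'v) proc \<Rightarrow> bool" where
  "wt_after Tau \<sigma> \<Delta> P \<longleftrightarrow> Cur \<in> dom \<Delta> \<and> wt P \<sigma> \<Delta>"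
| "wt_after (AHIn a v b) \<sigma> \<Delta> P \<longleftrightarrow> (Cur \<notin> dom \<Delta> \<longrightarrow>
     (\<exists>V. \<Delta> (Nm (\<sigma> a)) = Some V \<and> wt P (bind_env \<sigma> b) (input_vis \<Delta> V)))"
| "wt_after (AHOut a v b) \<sigma> \<Delta> P \<longleftrightarrow>
     (\<exists>V. \<Delta> Cur = Some V \<and> \<sigma> a \<in> V \<and> wt P (bind_env \<sigma> b) (output_vis \<Delta> V))"
| "wt_after (AFIn h v) \<sigma> \<Delta> P \<longleftrightarrow> Cur \<in> dom \<Delta> \<and> wt P \<sigma> \<Delta>"
| "wt_after (AFOut h v) \<sigma> \<Delta> P \<longleftrightarrow> wt P \<sigma> \<Delta>"
| "wt_after (ASucc w) \<sigma> \<Delta> P \<longleftrightarrow> True"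

lemma wt_Par_commute: "wt (Par P Q) \<sigma> \<Delta> \<longleftrightarrow> wt (Par Q P) \<sigma> \<Delta>"
  unfolding wt_Par by blast

lemma wt_after_Par_commute: "wt_after \<mu> \<sigma> \<Delta> (Par P Q) \<longleftrightarrow> wt_after \<mu> \<sigma> \<Delta> (Par Q P)"
  by (cases \<mu>) (simp_all only: wt_after.simps wt_Par_commute[of P Q])

lemma drop_Cur_idem: "Cur \<notin> dom \<Delta> \<Longrightarrow> \<Delta>(Cur := None) = \<Delta>"
  by (auto simp: domIff)

text \<open>For the component that does not move. The bound name is fresh for it, so its nodes are
  merely shifted and node 0 may have any value.\<close>

lemma wt_shift:
  assumes "wt P \<sigma> (\<Delta>(Cur := None))" and "b \<notin> fn P" and "transitive \<Delta>'" and "Cur \<notin> dom \<Delta>'"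
    and "\<And>n. shift \<Delta> (Nm (Suc n)) = \<Delta>' (Nm (Suc n))"
  shows "wt P (bind_env \<sigma> b) \<Delta>'"
proof (rule wt_embeds[OF assms(1) _ assms(3)])
  show "embeds Suc (\<Delta>(Cur := None)) \<Delta>'"
    unfolding embeds_def
  proof (intro conjI allI impI)
    fix p V
    assume "(\<Delta>(Cur := None)) p = Some V"
    then show "\<exists>V'. \<Delta>' (map_point Suc p) = Some V' \<and> Suc ` V \<subseteq> V'"
      using assms(5) by (cases p) (auto split: if_splits simp flip: assms(5))
  qed (use assms(4) in auto)
  show "bind_env \<sigma> b n = Suc (\<sigma> n)" if "n \<in> fn P" for n
    using that assms(2) by (auto simp: bind_env_def)
qed

lemma wt_after_ParL:
  assumes "bn \<mu> \<inter> fn Q = {}" and tr: "transitive \<Delta>"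
    and "wt_after \<mu> \<sigma> \<Delta> P \<and> wt Q \<sigma> (\<Delta>(Cur := None)) \<or>
         wt_after \<mu> \<sigma> (\<Delta>(Cur := None)) P \<and> wt Q \<sigma> \<Delta>"
  shows "wt_after \<mu> \<sigma> \<Delta> (Par P Q)"
proof (cases \<mu>)
  case (AHIn a v b)
  have "\<exists>V. \<Delta> (Nm (\<sigma> a)) = Some V \<and> wt (Par P Q) (bind_env \<sigma> b) (input_vis \<Delta> V)"
    if noCur: "Cur \<notin> dom \<Delta>"
  proof -
    have id: "\<Delta>(Cur := None) = \<Delta>"
      using noCur by (rule drop_Cur_idem)
    then obtain V where V: "\<Delta> (Nm (\<sigma> a)) = Some V" "wt P (bind_env \<sigma> b) (input_vis \<Delta> V)"
      and Q: "wt Q \<sigma> (\<Delta>(Cur := None))"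
      using assms(3) noCur unfolding AHIn id wt_after.simps by blast
    have "wt Q (bind_env \<sigma> b) ((input_vis \<Delta> V)(Cur := None))"
    proof (rule wt_shift[OF Q])
      show "b \<notin> fn Q"
        using assms(1) AHIn by simp
      show "transitive ((input_vis \<Delta> V)(Cur := None))"
        using transitive_drop_Cur[OF transitive_input_vis[OF tr V(1)]] .
    qed (auto simp: input_vis_def)
    then show ?thesis
      using V unfolding wt_Par by blast
  qed
  then show ?thesis
    unfolding AHIn by simp
next
  case (AHOut a v b)
  \<comment> \<open>An output needs \<open>Cur\<close>, which excludes the second
    alternative.\<close>
  then obtain V where V: "\<Delta> Cur = Some V" "\<sigma> a \<in> V" "wt P (bind_env \<sigma> b) (output_vis \<Delta> V)"
    and Q: "wt Q \<sigma> (\<Delta>(Cur := None))"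
    using assms(3) by auto
  have noCur: "Cur \<notin> dom (output_vis \<Delta> V)"
    by (auto simp: output_vis_def)
  have "wt Q (bind_env \<sigma> b) (output_vis \<Delta> V)"
  proof (rule wt_shift[OF Q _ _ noCur])
    show "b \<notin> fn Q"
      using assms(1) AHOut by simp
    show "transitive (output_vis \<Delta> V)"
      using transitive_output_vis[OF tr V(1)] .
  qed (auto simp: output_vis_def)
  then have "wt (Par P Q) (bind_env \<sigma> b) (output_vis \<Delta> V)"
    using V(3) unfolding wt_Par drop_Cur_idem[OF noCur] by blast
  then show ?thesis
    using V(1,2) unfolding AHOut by auto
qed (use assms(3) in \<open>auto simp: wt_Par simp del: fun_upd_apply\<close>)

text \<open>The sender sees \<open>a\<close>, so transitivity puts all that \<open>a\<close> sees
  inside the sender's set. The receiver inherits \<open>Cur\<close> and can be weakened to that set,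
  which stays within what \<open>\<Delta>\<close> grants to \<open>Cur\<close>.\<close>

lemma wt_HCom:
  assumes tr: "transitive \<Delta>"
    and P: "wt_after (AHIn a v b) \<sigma> (\<Delta>(Cur := None)) P" and Q: "wt_after (AHOut a v b) \<sigma> \<Delta> Q"
  shows "wt (HNu b (Par P Q)) \<sigma> \<Delta>"
proof -
  obtain V where V: "\<Delta> Cur = Some V" "\<sigma> a \<in> V" "wt Q (bind_env \<sigma> b) (output_vis \<Delta> V)"
    using Q by auto
  obtain W where W: "\<Delta> (Nm (\<sigma> a)) = Some W"
      "wt P (bind_env \<sigma> b) (input_vis (\<Delta>(Cur := None)) W)"
    using P by auto
  have "W \<subseteq> V"
    using transitiveD[OF tr V(1,2) W(1)] .
  \<comment> \<open>\<open>Cur\<close> sees node 0 and node 0 sees all of \<open>V\<close>, so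
    \<open>W\<close> in place of \<open>V\<close> would break transitivity.\<close>
  define \<Delta>' where "\<Delta>' = (output_vis \<Delta> V)(Cur \<mapsto> insert 0 (Suc ` V))"
  have "output_vis \<Delta> V (Nm 0) = Some (insert 0 (Suc ` V))"
    by (simp add: output_vis_def)
  then have tr': "transitive \<Delta>'"
    using transitive_output_vis[OF tr V(1)] unfolding transitive_def \<Delta>'_def
    by (metis fun_upd_apply option.inject point.distinct(1))
  have "drop_le \<Delta>' \<Delta>"
    unfolding drop_le_def
  proof (intro conjI allI impI)
    fix p V'
    assume "\<Delta>' (map_point Suc p) = Some V'"
    then show "\<exists>V. \<Delta> p = Some V \<and> Suc -` V' \<subseteq> V"
      using V(1) by (cases p) (auto simp: \<Delta>'_def output_vis_def)
  qed (simp add: \<Delta>'_def)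
  moreover have "wt P (bind_env \<sigma> b) \<Delta>'"
  proof (rule wt_embeds[OF W(2) _ tr', where f = id])
    show "embeds id (input_vis (\<Delta>(Cur := None)) W) \<Delta>'"
      unfolding embeds_def
    proof (intro conjI allI impI)
      fix p U
      assume U: "input_vis (\<Delta>(Cur := None)) W p = Some U"
      show "\<exists>V'. \<Delta>' (map_point id p) = Some V' \<and> id ` U \<subseteq> V'"
      proof (cases p)
        case Cur
        then show ?thesis using U \<open>W \<subseteq> V\<close> by (auto simp: \<Delta>'_def input_vis_def)
      next
        case (Nm n)
        then show ?thesis using U by (cases n) (auto simp: \<Delta>'_def input_vis_def output_vis_def)
      qed
    qed (simp add: input_vis_def)
  qed simp
  moreover have "\<Delta>'(Cur := None) = output_vis \<Delta> V"
    by (auto simp: \<Delta>'_def output_vis_def)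
  ultimately show ?thesis
    using tr' V(3) unfolding wt_HNu wt_Par by metis
qed

abbreviation swap01 :: "nat \<Rightarrow> nat" where
  "swap01 \<equiv> transpose 0 (Suc 0)"

text \<open>The binder of a restriction moves below the bound name of the action that passes it.\<close>

lemma wt_HNu_exchange:
  assumes "wt P (bind_env (bind_env \<sigma> a) b) \<Delta>'" and "transitive \<Delta>'" and "a \<noteq> b"
    and "drop_le (image_vis swap01 \<Delta>') \<Delta>"
  shows "wt (HNu a P) (bind_env \<sigma> b) \<Delta>"
proof -
  have tr: "transitive (image_vis swap01 \<Delta>')"
    by (rule transitive_image_vis) (auto simp: assms(2))
  have "wt P (bind_env (bind_env \<sigma> b) a) (image_vis swap01 \<Delta>')"
    by (rule wt_embeds[OF assms(1) embeds_image_vis tr])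
      (use assms(3) in \<open>auto simp: bind_env_def transpose_def\<close>)
  then show ?thesis
    using tr assms(4) unfolding wt_HNu by blast
qed

lemma drop_leD:
  "drop_le \<Delta>' \<Delta> \<Longrightarrow> \<Delta>' (map_point Suc p) = Some V' \<Longrightarrow> \<exists>V. \<Delta> p = Some V \<and> Suc -` V' \<subseteq> V"
  unfolding drop_le_def by blast

lemma drop_le_Cur: "drop_le \<Delta>' \<Delta> \<Longrightarrow> Cur \<in> dom \<Delta>' \<longleftrightarrow> Cur \<in> dom \<Delta>"
  unfolding drop_le_def by (metis domD domI map_point.simps(1))

lemma Suc_mem_swap01: "Suc n \<in> swap01 ` V \<longleftrightarrow> (if n = 0 then 0 \<in> V else Suc n \<in> V)"
proof -
  have "Suc n \<in> swap01 ` V \<longleftrightarrow> swap01 (Suc n) \<in> V"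
    by (auto intro: image_eqI[of _ _ "swap01 (Suc n)"] simp del: transpose_apply_first transpose_apply_second)
  then show ?thesis
    by (auto simp: transpose_def)
qed

text \<open>Swapping and then forgetting node 0 removes the old node 1, keeps the old node 0, and
  moves every higher node down by one.\<close>

lemma vimage_swap01_subset:
  "Suc -` swap01 ` V \<subseteq> W \<longleftrightarrow> (0 \<in> V \<longrightarrow> 0 \<in> W) \<and> (\<forall>n. Suc (Suc n) \<in> V \<longrightarrow> Suc n \<in> W)"
proof -
  have "(\<forall>n. (if n = 0 then 0 \<in> V else Suc n \<in> V) \<longrightarrow> n \<in> W) \<longleftrightarrow>
      (0 \<in> V \<longrightarrow> 0 \<in> W) \<and> (\<forall>n. Suc (Suc n) \<in> V \<longrightarrow> Suc n \<in> W)"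
    by (metis nat.distinct(1) not0_implies_Suc)
  then show ?thesis
    unfolding subset_iff vimage_eq Suc_mem_swap01 .
qed

lemma image_vis_swap01:
  "image_vis swap01 \<Delta> (map_point Suc p) = map_option (image swap01)
     (\<Delta> (if p = Nm 0 then Nm 0 else map_point Suc p))"
proof -
  have "map_point Suc p = map_point swap01 (if p = Nm 0 then Nm 0 else map_point Suc p)"
    by (cases p) (auto simp: transpose_def)
  then show ?thesis
    using image_vis_map_point[of swap01 \<Delta>] by (metis inj_transpose)
qed

text \<open>Forgetting the restricted name commutes with adding the bound name of the action, up to
  the swap that brings the restricted name back to node 0.\<close>

lemma drop_le_input_vis:
  assumes le: "drop_le \<Delta>' \<Delta>" and "Suc -` V' \<subseteq> V"
  shows "drop_le (image_vis swap01 (input_vis \<Delta>' V')) (input_vis \<Delta> V)"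
  unfolding drop_le_def
proof (intro conjI allI impI)
  fix p U'
  assume U': "image_vis swap01 (input_vis \<Delta>' V') (map_point Suc p) = Some U'"
  show "\<exists>U. input_vis \<Delta> V p = Some U \<and> Suc -` U' \<subseteq> U"
  proof (cases p)
    case Cur
    then have *: "U' = swap01 ` insert 0 (Suc ` V')"
      using U' unfolding image_vis_swap01 by (simp add: input_vis_def del: image_insert)
    have "Suc -` U' \<subseteq> insert 0 (Suc ` V)"
      using assms(2) unfolding * vimage_swap01_subset by auto
    then show ?thesis
      using Cur by (simp add: input_vis_def)
  next
    case (Nm n)
    then obtain k W where n: "n = Suc k" and W: "\<Delta>' (Nm n) = Some W" "U' = swap01 ` Suc ` W"
      using U' unfolding image_vis_swap01 by (cases n) (auto simp: input_vis_def)
    obtain U where U: "\<Delta> (Nm k) = Some U" "Suc -` W \<subseteq> U"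
      using drop_leD[OF le, of "Nm k"] W(1) n by auto
    have "Suc -` U' \<subseteq> Suc ` U"
      using U(2) unfolding W(2) vimage_swap01_subset by auto
    then show ?thesis
      using Nm n U(1) by (simp add: input_vis_def)
  qed
next
  show "Cur \<in> dom (image_vis swap01 (input_vis \<Delta>' V'))"
    using image_vis_swap01[of "input_vis \<Delta>' V'" Cur] by (auto simp: input_vis_def)
qed

lemma drop_le_output_vis:
  assumes le: "drop_le \<Delta>' \<Delta>" and "Suc -` V' \<subseteq> V"
  shows "drop_le (image_vis swap01 (output_vis \<Delta>' V')) (output_vis \<Delta> V)"
  unfolding drop_le_def
proof (intro conjI allI impI)
  fix p U'
  assume U': "image_vis swap01 (output_vis \<Delta>' V') (map_point Suc p) = Some U'"
  show "\<exists>U. output_vis \<Delta> V p = Some U \<and> Suc -` U' \<subseteq> U"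
  proof (cases "p = Nm 0")
    case True
    then have *: "U' = swap01 ` insert 0 (Suc ` V')"
      using U' unfolding image_vis_swap01 by (simp add: output_vis_def del: image_insert)
    have "Suc -` U' \<subseteq> insert 0 (Suc ` V)"
      using assms(2) unfolding * vimage_swap01_subset by auto
    then show ?thesis
      using True by (simp add: output_vis_def)
  next
    case False
    then obtain k W where p: "p = Nm (Suc k)" and W: "\<Delta>' (Nm (Suc k)) = Some W" "U' = swap01 ` Suc ` W"
      using U' unfolding image_vis_swap01
      by (cases p; cases "case p of Nm n \<Rightarrow> n | Cur \<Rightarrow> 0") (auto simp: output_vis_def)
    obtain U where U: "\<Delta> (Nm k) = Some U" "Suc -` W \<subseteq> U"
      using drop_leD[OF le, of "Nm k"] W(1) by auto
    have "Suc -` U' \<subseteq> Suc ` U"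
      using U(2) unfolding W(2) vimage_swap01_subset by auto
    then show ?thesis
      using p U(1) by (simp add: output_vis_def)
  qed
qed (simp add: output_vis_def)

text \<open>In a communication the two ways of typing a parallel composition are told apart by the
  partner that must hold \<open>Cur\<close>: the sender at a higher-order name, the receiver at a
  first-order one. \<open>\<sigma>\<close> and \<open>\<Delta>\<close> are general because
  restriction extends both.\<close>

theorem subject_reduction:
  "lts I P \<mu> P' \<Longrightarrow> transitive \<Delta> \<Longrightarrow> wt P \<sigma> \<Delta> \<Longrightarrow> wt_after \<mu> \<sigma> \<Delta> P'"
proof (induction arbitrary: \<sigma> \<Delta> rule: lts.induct)
  case (lts_HBang a x b P \<mu> P')
  have "Cur \<notin> dom \<Delta>"
    using lts_HBang.prems(2) unfolding wt_HBang wt_HIn by blast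
  then have "wt (Par (HIn a x b P) (HBang a x b P)) \<sigma> \<Delta>"
    using lts_HBang.prems(2) unfolding wt_HBang wt_Par drop_Cur_idem[OF \<open>Cur \<notin> dom \<Delta>\<close>] by blast
  then show ?case
    using lts_HBang by blast
next
  case (lts_FBang h x P \<mu> P')
  then show ?case by (simp add: wt_FBang)
next
  case (lts_HNu P \<mu> P' a)
  obtain \<Delta>' where \<Delta>': "transitive \<Delta>'" "drop_le \<Delta>' \<Delta>" "wt P (bind_env \<sigma> a) \<Delta>'"
    using lts_HNu.prems(2) unfolding wt_HNu by blast
  have IH: "wt_after \<mu> (bind_env \<sigma> a) \<Delta>' P'"
    using lts_HNu.IH[OF \<Delta>'(1,3)] .
  have Cur: "Cur \<in> dom \<Delta>' \<longleftrightarrow> Cur \<in> dom \<Delta>"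
    using drop_le_Cur[OF \<Delta>'(2)] .
  show ?case
  proof (cases \<mu>)
    case (AHIn c v b)
    have ne: "a \<noteq> c" "a \<noteq> b"
      using lts_HNu.hyps(2) AHIn by auto
    show ?thesis
      unfolding AHIn wt_after.simps
    proof
      assume "Cur \<notin> dom \<Delta>"
      then obtain V' where V': "\<Delta>' (map_point Suc (Nm (\<sigma> c))) = Some V'"
          "wt P' (bind_env (bind_env \<sigma> a) b) (input_vis \<Delta>' V')"
        using IH ne Cur unfolding AHIn by (auto simp: bind_env_def[of \<sigma> a c])
      obtain V where V: "\<Delta> (Nm (\<sigma> c)) = Some V" "Suc -` V' \<subseteq> V"
        using drop_leD[OF \<Delta>'(2) V'(1)] by blast
      have "wt (HNu a P') (bind_env \<sigma> b) (input_vis \<Delta> V)"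
        using wt_HNu_exchange[OF V'(2) transitive_input_vis[OF \<Delta>'(1) V'(1)] ne(2)
            drop_le_input_vis[OF \<Delta>'(2) V(2)]] .
      then show "\<exists>V. \<Delta> (Nm (\<sigma> c)) = Some V \<and> wt (HNu a P') (bind_env \<sigma> b) (input_vis \<Delta> V)"
        using V(1) by blast
    qed
  next
    case (AHOut c v b)
    have ne: "a \<noteq> c" "a \<noteq> b"
      using lts_HNu.hyps(2) AHOut by auto
    obtain V' where V': "\<Delta>' Cur = Some V'" "Suc (\<sigma> c) \<in> V'"
        "wt P' (bind_env (bind_env \<sigma> a) b) (output_vis \<Delta>' V')"
      using IH ne unfolding AHOut by (auto simp: bind_env_def[of \<sigma> a c])
    obtain V where V: "\<Delta> Cur = Some V" "Suc -` V' \<subseteq> V"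
      using drop_leD[OF \<Delta>'(2), of Cur] V'(1) by auto
    have "wt (HNu a P') (bind_env \<sigma> b) (output_vis \<Delta> V)"
      using wt_HNu_exchange[OF V'(3) transitive_output_vis[OF \<Delta>'(1) V'(1)] ne(2)
          drop_le_output_vis[OF \<Delta>'(2) V(2)]] .
    then show ?thesis
      using V V'(2) unfolding AHOut by auto
  qed (use IH \<Delta>' Cur in \<open>auto simp: wt_HNu\<close>)
next
  case (lts_FNu P \<mu> P' h)
  then have "wt_after \<mu> \<sigma> \<Delta> P'"
    unfolding wt_FNu by blast
  then show ?case
    by (cases \<mu>) (auto simp: wt_FNu)
next
  case (lts_ParL P \<mu> P' Q)
  then show ?case
    using wt_after_ParL[OF lts_ParL.hyps(2), of \<Delta> \<sigma> P'] transitive_drop_Cur unfolding wt_Par by blast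
next
  case (lts_ParR Q \<mu> Q' P)
  then show ?case
    using wt_after_ParL[OF lts_ParR.hyps(2), of \<Delta> \<sigma> Q'] transitive_drop_Cur
    unfolding wt_Par wt_after_Par_commute[of _ _ _ P] by blast
next
  case (lts_HComL P a v b P' Q Q')
  \<comment> \<open>The output cannot be typed without \<open>Cur\<close>, so the token went to
    \<open>Q\<close>.\<close>
  have no_Cur: "\<not> wt_after (AHOut a v b) \<sigma> (\<Delta>(Cur := None)) Q'"
    by simp
  have "wt P \<sigma> (\<Delta>(Cur := None)) \<and> wt Q \<sigma> \<Delta>"
    using no_Cur lts_HComL.prems(2) lts_HComL.IH(2)[OF transitive_drop_Cur[OF lts_HComL.prems(1)], of \<sigma>]
    unfolding wt_Par by blast
  then have after: "wt_after (AHIn a v b) \<sigma> (\<Delta>(Cur := None)) P'" "wt_after (AHOut a v b) \<sigma> \<Delta> Q'"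
    using lts_HComL transitive_drop_Cur by blast+
  show ?case
    using wt_HCom[OF lts_HComL.prems(1) after] after(2) by auto
next
  case (lts_HComR P a v b P' Q Q')
  have no_Cur: "\<not> wt_after (AHOut a v b) \<sigma> (\<Delta>(Cur := None)) P'"
    by simp
  have "wt Q \<sigma> (\<Delta>(Cur := None)) \<and> wt P \<sigma> \<Delta>"
    using no_Cur lts_HComR.prems(2) lts_HComR.IH(1)[OF transitive_drop_Cur[OF lts_HComR.prems(1)], of \<sigma>]
    unfolding wt_Par by blast
  then have after: "wt_after (AHIn a v b) \<sigma> (\<Delta>(Cur := None)) Q'" "wt_after (AHOut a v b) \<sigma> \<Delta> P'"
    using lts_HComR transitive_drop_Cur by blast+
  have "wt (HNu b (Par P' Q')) \<sigma> \<Delta>"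
    using wt_HCom[OF lts_HComR.prems(1) after] unfolding wt_HNu wt_Par_commute[of Q'] .
  then show ?case
    using after(2) by auto
next
  case (lts_FComL P h v P' Q Q')
  have no_Cur: "\<not> wt_after (AFIn h v) \<sigma> (\<Delta>(Cur := None)) P'"
    by simp
  have "wt Q \<sigma> (\<Delta>(Cur := None)) \<and> wt P \<sigma> \<Delta>"
    using no_Cur lts_FComL.prems(2) lts_FComL.IH(1)[OF transitive_drop_Cur[OF lts_FComL.prems(1)], of \<sigma>]
    unfolding wt_Par by blast
  then have "wt_after (AFOut h v) \<sigma> (\<Delta>(Cur := None)) Q'" "wt_after (AFIn h v) \<sigma> \<Delta> P'"
    using lts_FComL transitive_drop_Cur by blast+
  then show ?case
    unfolding wt_after.simps wt_Par by blast
next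
  case (lts_FComR P h v P' Q Q')
  have no_Cur: "\<not> wt_after (AFIn h v) \<sigma> (\<Delta>(Cur := None)) Q'"
    by simp
  have "wt P \<sigma> (\<Delta>(Cur := None)) \<and> wt Q \<sigma> \<Delta>"
    using no_Cur lts_FComR.prems(2) lts_FComR.IH(2)[OF transitive_drop_Cur[OF lts_FComR.prems(1)], of \<sigma>]
    unfolding wt_Par by blast
  then have "wt_after (AFOut h v) \<sigma> (\<Delta>(Cur := None)) P'" "wt_after (AFIn h v) \<sigma> \<Delta> Q'"
    using lts_FComR transitive_drop_Cur by blast+
  then show ?case
    unfolding wt_after.simps wt_Par by blast
qed (auto simp: wt_simps)

section \<open>The observer relation\<close>

lemma lts_subject_neq_bn: "lts I P \<mu> P' \<Longrightarrow> \<mu> = AHIn a v b \<or> \<mu> = AHOut a v b \<Longrightarrow> a \<noteq> b"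
  by (induction rule: lts.induct) auto

text \<open>Neither \<open>b\<close> nor \<open>b'\<close> is free in \<open>P\<close>, and neither
  is the subject, so the swap fixes the source and only exchanges the bound name.\<close>

lemma lts_rename_bn:
  assumes "lts I P \<mu> P'" and "b' \<notin> fn P" and "b' \<noteq> a"
  shows "\<mu> = AHIn a v b \<Longrightarrow> lts I P (AHIn a v b') (rename (transpose b b') P')"
    and "\<mu> = AHOut a v b \<Longrightarrow> lts I P (AHOut a v b') (rename (transpose b b') P')"
proof -
  have *: "lts I (rename (transpose b b') P) (rename_act (transpose b b') \<mu>) (rename (transpose b b') P')"
    using lts_rename[OF assms(1)] by simp
  have P: "rename (transpose b b') P = P" if "b \<in> bn \<mu>"
    using that lts_bn_fresh[OF assms(1)] assms(2) by (intro rename_fresh transpose_apply_other) auto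
  show "\<mu> = AHIn a v b \<Longrightarrow> lts I P (AHIn a v b') (rename (transpose b b') P')"
    and "\<mu> = AHOut a v b \<Longrightarrow> lts I P (AHOut a v b') (rename (transpose b b') P')"
    using * P assms(3) lts_subject_neq_bn[OF assms(1), of a v b] by (auto simp: transpose_apply_other)
qed

lemma fresh_name:
  assumes "finite X"
  obtains b :: hname where "b \<notin> X"
  using assms ex_new_if_finite infinite_UNIV_nat by blast

lemma HCom_fresh:
  assumes com: "lts I P (AHIn a v b) P' \<and> lts I R (AHOut a v b) R' \<or>
      lts I P (AHOut a v b) P' \<and> lts I R (AHIn a v b) R'"
    and "b' \<notin> fn P" "b' \<notin> fn R"
  shows "HNu b (Par P' R') = HNu b' (Par (rename (transpose b b') P') (rename (transpose b b') R'))"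
proof -
  have "fn (Par P' R') \<subseteq> fn P \<union> fn R \<union> {b}"
    using com lts_fn by fastforce
  then have "b' \<notin> fn (Par P' R') \<or> b = b'"
    using assms(2,3) by blast
  then show ?thesis
    using HNu_alpha[of b' "Par P' R'" b] by simp
qed

lemma finite_vis_names:
  assumes "visibility \<Gamma>"
  shows "finite (vis_names \<Gamma>)"
proof -
  have "{a. Nm a \<in> dom \<Gamma>} = Nm -` dom \<Gamma>"
    by auto
  moreover have "finite (Nm -` dom \<Gamma>)"
    using assms by (intro finite_vimageI) (auto simp: visibility_def inj_def)
  moreover have "ran \<Gamma> = the ` \<Gamma> ` dom \<Gamma>"
    by (force simp: ran_def image_iff dom_def)
  then have "finite (ran \<Gamma>)"
    using assms by (simp add: visibility_def)
  ultimately show ?thesis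
    using assms by (auto simp: vis_names_def visibility_def)
qed

lemma typed_bisimilarity_visibility: "(\<Gamma>, P, Q) \<in> typed_bisimilarity I \<Longrightarrow> visibility \<Gamma>"
  unfolding typed_bisimilarity_def typed_bisimulation_def by blast

lemma typed_bisimilarity_step:
  assumes "(\<Gamma>, P, Q) \<in> typed_bisimilarity I" and "ttrans I \<Gamma> P \<mu> \<Gamma>' P'" and "bn \<mu> \<inter> fn Q = {}"
  shows "\<exists>Q'. wtrans I \<Gamma> Q \<mu> \<Gamma>' Q' \<and> (\<Gamma>', P', Q') \<in> typed_bisimilarity I"
proof -
  obtain \<R> where \<R>: "typed_bisimulation I \<R>" "(\<Gamma>, P, Q) \<in> \<R>"
    using assms(1) unfolding typed_bisimilarity_def by blast
  then obtain Q' where "wtrans I \<Gamma> Q \<mu> \<Gamma>' Q'" "(\<Gamma>', P', Q') \<in> \<R>"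
    using assms(2,3) unfolding typed_bisimulation_def by blast
  then show ?thesis
    using \<R>(1) unfolding typed_bisimilarity_def by blast
qed

lemma typed_bisimilarity_sym:
  assumes "(\<Gamma>, P, Q) \<in> typed_bisimilarity I"
  shows "(\<Gamma>, Q, P) \<in> typed_bisimilarity I"
proof -
  obtain \<R> where \<R>: "typed_bisimulation I \<R>" "(\<Gamma>, P, Q) \<in> \<R>"
    using assms unfolding typed_bisimilarity_def by blast
  define \<S> where "\<S> = {(\<Gamma>, Q, P) | \<Gamma> P Q. (\<Gamma>, P, Q) \<in> \<R>}"
  have "typed_bisimulation I \<S>"
    unfolding typed_bisimulation_def
  proof safe
    fix \<Gamma> Q P
    assume "(\<Gamma>, Q, P) \<in> \<S>"
    then have "(\<Gamma>, P, Q) \<in> \<R>"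
      by (simp add: \<S>_def)
    note * = bspec[OF \<R>(1)[unfolded typed_bisimulation_def] this, simplified]
    show "visibility \<Gamma>"
      using * by blast
    show "\<exists>P'. wtrans I \<Gamma> P \<mu> \<Gamma>' P' \<and> (\<Gamma>', Q', P') \<in> \<S>"
      if "ttrans I \<Gamma> Q \<mu> \<Gamma>' Q'" "bn \<mu> \<inter> fn P = {}" for \<mu> \<Gamma>' Q'
      using * that by (simp add: \<S>_def)
    show "\<exists>Q'. wtrans I \<Gamma> Q \<mu> \<Gamma>' Q' \<and> (\<Gamma>', Q', P') \<in> \<S>"
      if "ttrans I \<Gamma> P \<mu> \<Gamma>' P'" "bn \<mu> \<inter> fn Q = {}" for \<mu> \<Gamma>' P'
      using * that by (simp add: \<S>_def)
  qed
  then show ?thesis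
    using \<R>(2) unfolding typed_bisimilarity_def \<S>_def by blast
qed

text \<open>
  The context of a compared process is existential because it need not be the same for \<open>P\<close> and \<open>Q\<close>;
  only the ownership of \<open>Cur\<close> matters.
\<close>

definition separated :: "vis \<Rightarrow> ('f, 'v) proc \<Rightarrow> bool" where
  "separated \<Gamma> P \<longleftrightarrow> (\<exists>\<sigma> \<Delta>. transitive \<Delta> \<and> wt P \<sigma> \<Delta> \<and> (Cur \<in> dom \<Gamma> \<longrightarrow> Cur \<notin> dom \<Delta>))"

lemma separated_noCur:
  assumes "separated \<Gamma> P" and "lts I P \<mu> P'"
    and "\<mu> = Tau \<or> (\<exists>h v. \<mu> = AFIn h v) \<or> (\<exists>a v b. \<mu> = AHOut a v b)"
  shows "Cur \<notin> dom \<Gamma>"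
proof -
  obtain \<sigma> \<Delta> where \<Delta>: "transitive \<Delta>" "wt P \<sigma> \<Delta>" "Cur \<in> dom \<Gamma> \<longrightarrow> Cur \<notin> dom \<Delta>"
    using assms(1) unfolding separated_def by blast
  have "wt_after \<mu> \<sigma> \<Delta> P'"
    using subject_reduction[OF assms(2) \<Delta>(1,2)] .
  then show ?thesis
    using \<Delta>(3) assms(3) by auto
qed

text \<open>A higher-order output hands \<open>Cur\<close> to the observer and a higher-order input
  takes it back. Success is excluded: \<open>Succ w P\<close> is typable with \<open>Cur\<close>,
  its residual \<open>PNil\<close> is not.\<close>

lemma separated_ttrans:
  assumes "ttrans I \<Gamma> P \<mu> \<Gamma>' P'" and "separated \<Gamma> P" and "\<And>w. \<mu> \<noteq> ASucc w"
  shows "separated \<Gamma>' P'"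
proof -
  obtain \<sigma> \<Delta> where \<Delta>: "transitive \<Delta>" "wt P \<sigma> \<Delta>" "Cur \<in> dom \<Gamma> \<longrightarrow> Cur \<notin> dom \<Delta>"
    using assms(2) unfolding separated_def by blast
  have "lts I P \<mu> P'"
    using assms(1) by (cases rule: ttrans.cases) auto
  then have after: "wt_after \<mu> \<sigma> \<Delta> P'"
    using subject_reduction \<Delta>(1,2) by blast
  show ?thesis
    using assms(1)
  proof (cases rule: ttrans.cases)
    case (ttrans_HOut a v b V)
    then obtain W where W: "\<Delta> Cur = Some W" "wt P' (bind_env \<sigma> b) (output_vis \<Delta> W)"
      using after by auto
    have "Cur \<notin> dom (output_vis \<Delta> W)"
      by (auto simp: output_vis_def)
    then show ?thesis
      using W transitive_output_vis[OF \<Delta>(1)] unfolding separated_def by blast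
  next
    case (ttrans_HIn a v b V)
    then have "Cur \<notin> dom \<Delta>"
      using \<Delta>(3) by blast
    then obtain W where W: "\<Delta> (Nm (\<sigma> a)) = Some W" "wt P' (bind_env \<sigma> b) (input_vis \<Delta> W)"
      using after ttrans_HIn by auto
    have "Cur \<notin> dom \<Gamma>'"
      using ttrans_HIn by (auto simp: erase_def)
    then show ?thesis
      using W transitive_input_vis[OF \<Delta>(1)] unfolding separated_def by blast
  qed (use after \<Delta> assms(3) in \<open>auto simp: separated_def\<close>)
qed

lemma separated_ttaus:
  assumes "ttaus I \<Gamma> P P'" and "separated \<Gamma> P"
  shows "separated \<Gamma> P'"
  using assms unfolding ttaus_def by (induction rule: rtranclp_induct) (auto dest: separated_ttrans)

lemma separated_wtrans:
  assumes "wtrans I \<Gamma> P \<mu> \<Gamma>' P'" and "separated \<Gamma> P" and "\<And>w. \<mu> \<noteq> ASucc w"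
  shows "separated \<Gamma>' P'"
  using assms unfolding wtrans_def
  by (auto split: if_splits dest: separated_ttaus) (metis separated_ttaus separated_ttrans assms(3))

lemma ttrans_lts: "ttrans I \<Gamma> P \<mu> \<Gamma>' P' \<Longrightarrow> lts I P \<mu> P'"
  by (auto elim: ttrans.cases)

lemma reds_refl: "reds I P P"
  by (simp add: reds_def)

lemma reds_trans: "reds I P Q \<Longrightarrow> reds I Q R \<Longrightarrow> reds I P R"
  by (simp add: reds_def)

lemma lts_reds: "lts I P Tau Q \<Longrightarrow> reds I P Q"
  by (simp add: reds_def red_def r_into_rtranclp)

lemma reds_HNu: "reds I P P' \<Longrightarrow> reds I (HNu a P) (HNu a P')"
  unfolding reds_def
proof (induction rule: rtranclp_induct)
  case (step P' P'')
  have "red I (HNu a P') (HNu a P'')"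
    using step.hyps(2) by (auto simp: red_def intro: lts_HNu)
  then show ?case
    using step.IH by (rule rtranclp.rtrancl_into_rtrancl[rotated])
qed simp

lemma ttaus_reds_Par: "ttaus I \<Gamma> P P' \<Longrightarrow> reds I (Par P R) (Par P' R)"
  unfolding reds_def ttaus_def
proof (induction rule: rtranclp_induct)
  case (step P' P'')
  have "red I (Par P' R) (Par P'' R)"
    using ttrans_lts[OF step.hyps(2)] by (auto simp: red_def intro: lts_ParL)
  then show ?case
    using step.IH by (rule rtranclp.rtrancl_into_rtrancl[rotated])
qed simp

section \<open>Residuals of the observer\<close>

text \<open>\<open>case_nat b id\<close> instantiates node 0 by \<open>b\<close> and undoes the
  shift, so names are again their own nodes and the context is the one in the typed transition. Its
  transitivity stays a premise, to be supplied by the matching triple in typed bisimilarity.\<close>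

lemma wt_id_input:
  assumes "transitive \<Gamma>" and "wt R id \<Gamma>" and "lts I R (AHIn a v b) R'" and "Cur \<notin> dom \<Gamma>"
  obtains V where "\<Gamma> (Nm a) = Some V"
    and "transitive (\<Gamma>(Cur \<mapsto> V \<union> {b})) \<Longrightarrow> wt R' id (\<Gamma>(Cur \<mapsto> V \<union> {b}))"
proof -
  obtain V where V: "\<Gamma> (Nm a) = Some V" "wt R' (bind_env id b) (input_vis \<Gamma> V)"
    using subject_reduction[OF assms(3,1,2)] assms(4) by auto
  let ?f = "case_nat b id"
  have "embeds ?f (input_vis \<Gamma> V) (\<Gamma>(Cur \<mapsto> V \<union> {b}))"
    unfolding embeds_def
  proof (intro conjI allI impI)
    fix p U
    assume U: "input_vis \<Gamma> V p = Some U"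
    show "\<exists>U'. (\<Gamma>(Cur \<mapsto> V \<union> {b})) (map_point ?f p) = Some U' \<and> ?f ` U \<subseteq> U'"
    proof (cases p)
      case Cur
      then show ?thesis using U by (auto simp: input_vis_def)
    next
      case (Nm n)
      then show ?thesis using U by (cases n) (auto simp: input_vis_def)
    qed
  qed (simp add: input_vis_def)
  then have "wt R' id (\<Gamma>(Cur \<mapsto> V \<union> {b}))" if "transitive (\<Gamma>(Cur \<mapsto> V \<union> {b}))"
    by (rule wt_embeds[OF V(2) _ that]) (simp add: bind_env_def)
  then show ?thesis
    using V(1) that by blast
qed

lemma wt_id_output:
  assumes "transitive \<Gamma>" and "wt R id \<Gamma>" and "lts I R (AHOut a v b) R'" and "b \<notin> vis_names \<Gamma>"
  obtains V where "\<Gamma> Cur = Some V" and "a \<in> V"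
    and "transitive ((erase \<Gamma> Cur)(Nm b \<mapsto> V \<union> {b})) \<Longrightarrow> wt R' id ((erase \<Gamma> Cur)(Nm b \<mapsto> V \<union> {b}))"
proof -
  obtain V where V: "\<Gamma> Cur = Some V" "a \<in> V" "wt R' (bind_env id b) (output_vis \<Gamma> V)"
    using subject_reduction[OF assms(3,1,2)] by auto
  let ?f = "case_nat b id" and ?\<Gamma> = "(erase \<Gamma> Cur)(Nm b \<mapsto> V \<union> {b})"
  have "embeds ?f (output_vis \<Gamma> V) ?\<Gamma>"
    unfolding embeds_def
  proof (intro conjI allI impI)
    fix p U
    assume U: "output_vis \<Gamma> V p = Some U"
    then obtain n where p: "p = Nm n"
      by (cases p) (auto simp: output_vis_def)
    show "\<exists>U'. ?\<Gamma> (map_point ?f p) = Some U' \<and> ?f ` U \<subseteq> U'"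
    proof (cases n)
      case 0
      then show ?thesis using U p by (auto simp: output_vis_def)
    next
      case (Suc m)
      then obtain W where W: "\<Gamma> (Nm m) = Some W" "U = Suc ` W"
        using U p by (auto simp: output_vis_def)
      \<comment> \<open>Freshness of \<open>b\<close> ensures that the update at \<open>Nm b\<close>
        overwrites no old value.\<close>
      then have "m \<noteq> b"
        using assms(4) by (auto simp: vis_names_def)
      then show ?thesis using W Suc p by (auto simp: erase_def)
    qed
  qed (auto simp: erase_def)
  then have "wt R' id ?\<Gamma>" if "transitive ?\<Gamma>"
    by (rule wt_embeds[OF V(3) _ that]) (simp add: bind_env_def)
  then show ?thesis
    using V(1,2) that by blast
qed

section \<open>The candidate barbed bisimulation\<close>

text \<open>Restrictions pile up because each higher-order synchronisation wraps both residuals in a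
  \<open>HNu\<close>.\<close>

inductive observed :: "('f \<Rightarrow> 'v list \<Rightarrow> 'v) \<Rightarrow> ('f, 'v) proc \<Rightarrow> ('f, 'v) proc \<Rightarrow> bool"
  for I :: "'f \<Rightarrow> 'v list \<Rightarrow> 'v" where
  observed_Par: "(\<Gamma>, P, Q) \<in> typed_bisimilarity I \<Longrightarrow> separated \<Gamma> P \<Longrightarrow> separated \<Gamma> Q \<Longrightarrow>
    wt R id \<Gamma> \<Longrightarrow> observed I (Par P R) (Par Q R)"
| observed_HNu: "observed I X Y \<Longrightarrow> observed I (HNu a X) (HNu a Y)"

lemma observed_sym: "observed I X Y \<Longrightarrow> observed I Y X"
  by (induction rule: observed.induct) (auto intro: observed.intros typed_bisimilarity_sym)

lemma observed_match:
  assumes bis: "(\<Gamma>, P, Q) \<in> typed_bisimilarity I" and sep: "separated \<Gamma> P" "separated \<Gamma> Q"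
    and step: "ttrans I \<Gamma> P \<mu> \<Gamma>' P'" and "bn \<mu> \<inter> fn Q = {}" and "\<And>w. \<mu> \<noteq> ASucc w"
    and R': "transitive \<Gamma>' \<Longrightarrow> wt R' id \<Gamma>'"
  obtains Q' where "wtrans I \<Gamma> Q \<mu> \<Gamma>' Q'" and "observed I (Par P' R') (Par Q' R')"
proof -
  obtain Q' where Q': "wtrans I \<Gamma> Q \<mu> \<Gamma>' Q'" "(\<Gamma>', P', Q') \<in> typed_bisimilarity I"
    using typed_bisimilarity_step[OF bis step assms(5)] by blast
  have "wt R' id \<Gamma>'"
    using R' typed_bisimilarity_visibility[OF Q'(2)] visibility_transitive by blast
  then have "observed I (Par P' R') (Par Q' R')"
    using observed_Par[OF Q'(2) separated_ttrans[OF step sep(1) assms(6)]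
        separated_wtrans[OF Q'(1) sep(2) assms(6)]] by blast
  with Q'(1) show ?thesis
    by (rule that)
qed

text \<open>\<open>C\<close> is what the synchronisation leaves around its residuals: a restriction
  for higher-order names, nothing for first-order ones.\<close>

lemma wtrans_com:
  assumes "wtrans I \<Gamma> Q \<mu> \<Gamma>' Q'" and "\<mu> \<noteq> Tau"
    and com: "\<And>Q1 Q2. lts I Q1 \<mu> Q2 \<Longrightarrow> lts I (Par Q1 R) Tau (C (Par Q2 R'))"
    and C: "\<And>X Y. reds I X Y \<Longrightarrow> reds I (C X) (C Y)"
  shows "reds I (Par Q R) (C (Par Q' R'))"
proof -
  obtain Q1 Q2 where Q: "ttaus I \<Gamma> Q Q1" "ttrans I \<Gamma> Q1 \<mu> \<Gamma>' Q2" "ttaus I \<Gamma>' Q2 Q'"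
    using assms(1,2) unfolding wtrans_def by auto
  have "reds I (Par Q1 R) (C (Par Q2 R'))"
    using com[OF ttrans_lts[OF Q(2)]] by (rule lts_reds)
  then show ?thesis
    using ttaus_reds_Par[OF Q(1)] C[OF ttaus_reds_Par[OF Q(3)]] reds_trans by blast
qed

lemma observed_Par_red:
  assumes bis: "(\<Gamma>, P, Q) \<in> typed_bisimilarity I" and sep: "separated \<Gamma> P" "separated \<Gamma> Q"
    and R: "wt R id \<Gamma>" and red: "lts I (Par P R) Tau X"
  shows "\<exists>Y. reds I (Par Q R) Y \<and> observed I X Y"
proof -
  have vis: "visibility \<Gamma>" and tr: "transitive \<Gamma>"
    using typed_bisimilarity_visibility[OF bis] visibility_transitive by blast+
  note match = observed_match[OF bis sep]
  note sr = subject_reduction[OF _ tr R]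
  have fresh: "\<exists>b. b \<notin> fn P \<union> fn Q \<union> fn R \<union> vis_names \<Gamma> \<union> {a}" for a
    using fresh_name[of "fn P \<union> fn Q \<union> fn R \<union> vis_names \<Gamma> \<union> {a}"] finite_vis_names[OF vis] finite_fn
    by (metis finite.emptyI finite.insertI finite_UnI)
  from red show ?thesis
  proof (cases rule: lts.cases)
    case (lts_ParL P0 P' R0)
    then have step: "lts I P Tau P'" and X: "X = Par P' R"
      by auto
    have tau: "ttrans I \<Gamma> P Tau \<Gamma> P'"
      using step separated_noCur[OF sep(1) step] by (auto intro: ttrans_Tau)
    obtain Q' where Q': "wtrans I \<Gamma> Q Tau \<Gamma> Q'" "observed I (Par P' R) (Par Q' R)"
      by (rule match[OF tau _ _ R]) auto
    then have "reds I (Par Q R) (Par Q' R)"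
      using ttaus_reds_Par unfolding wtrans_def by auto
    then show ?thesis
      using Q'(2) X by blast
  next
    case (lts_ParR R0 R' P0)
    then have step: "lts I R Tau R'" and X: "X = Par P R'"
      by auto
    have "wt R' id \<Gamma>"
      using sr[OF step] by simp
    then have "observed I X (Par Q R')"
      using observed_Par[OF bis sep] X by blast
    moreover have "reds I (Par Q R) (Par Q R')"
      using step by (intro lts_reds lts.lts_ParR) auto
    ultimately show ?thesis by blast
  next
    case (lts_HComL P0 a v b P' R0 R')
    then have com: "lts I P (AHIn a v b) P'" "lts I R (AHOut a v b) R'"
        and X: "X = HNu b (Par P' R')"
      by auto
    \<comment> \<open>The name \<open>b\<close> of the synchronisation may occur in \<open>Q\<close>
      or in \<open>\<Gamma>\<close>, but the bisimulation game is played only with fresh names.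
      Alpha-conversion of the resulting restriction allows the exchange.\<close>
    obtain c where c: "c \<notin> fn P" "c \<notin> fn Q" "c \<notin> fn R" "c \<notin> vis_names \<Gamma>" "c \<noteq> a"
      using fresh[of a] by blast
    define P1 R1 where "P1 = rename (transpose b c) P'" and "R1 = rename (transpose b c) R'"
    have com1: "lts I P (AHIn a v c) P1" "lts I R (AHOut a v c) R1"
      unfolding P1_def R1_def
      using lts_rename_bn(1)[OF com(1) c(1,5) refl] lts_rename_bn(2)[OF com(2) c(3,5) refl] .
    have X1: "X = HNu c (Par P1 R1)"
      unfolding X P1_def R1_def by (rule HCom_fresh[of I P a v b P' R R']) (use com c in auto)
    obtain V where V: "\<Gamma> Cur = Some V" "a \<in> V"
        "transitive ((erase \<Gamma> Cur)(Nm c \<mapsto> V \<union> {c})) \<Longrightarrow> wt R1 id ((erase \<Gamma> Cur)(Nm c \<mapsto> V \<union> {c}))"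
      using wt_id_output[OF tr R com1(2) c(4)] by blast
    obtain Q' where Q': "wtrans I \<Gamma> Q (AHIn a v c) ((erase \<Gamma> Cur)(Nm c \<mapsto> V \<union> {c})) Q'"
        "observed I (Par P1 R1) (Par Q' R1)"
      by (rule match[OF ttrans_HIn[OF com1(1) V(1,2) c(4)] _ _ V(3)]) (use c in auto)
    have "reds I (Par Q R) (HNu c (Par Q' R1))"
      by (rule wtrans_com[OF Q'(1)]) (auto intro: lts.lts_HComL com1(2) reds_HNu)
    then show ?thesis
      using observed_HNu[OF Q'(2)] X1 by blast
  next
    case (lts_HComR P0 a v b P' R0 R')
    then have com: "lts I P (AHOut a v b) P'" "lts I R (AHIn a v b) R'"
        and X: "X = HNu b (Par P' R')"
      by auto
    have noCur: "Cur \<notin> dom \<Gamma>"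
      using separated_noCur[OF sep(1) com(1)] by blast
    obtain c where c: "c \<notin> fn P" "c \<notin> fn Q" "c \<notin> fn R" "c \<notin> vis_names \<Gamma>" "c \<noteq> a"
      using fresh[of a] by blast
    define P1 R1 where "P1 = rename (transpose b c) P'" and "R1 = rename (transpose b c) R'"
    have com1: "lts I P (AHOut a v c) P1" "lts I R (AHIn a v c) R1"
      unfolding P1_def R1_def
      using lts_rename_bn(2)[OF com(1) c(1,5) refl] lts_rename_bn(1)[OF com(2) c(3,5) refl] .
    have X1: "X = HNu c (Par P1 R1)"
      unfolding X P1_def R1_def by (rule HCom_fresh[of I P a v b P' R R']) (use com c in auto)
    obtain V where V: "\<Gamma> (Nm a) = Some V"
        "transitive (\<Gamma>(Cur \<mapsto> V \<union> {c})) \<Longrightarrow> wt R1 id (\<Gamma>(Cur \<mapsto> V \<union> {c}))"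
      using wt_id_input[OF tr R com1(2) noCur] by blast
    obtain Q' where Q': "wtrans I \<Gamma> Q (AHOut a v c) (\<Gamma>(Cur \<mapsto> V \<union> {c})) Q'"
        "observed I (Par P1 R1) (Par Q' R1)"
      by (rule match[OF ttrans_HOut[OF com1(1) V(1) noCur c(4)] _ _ V(2)]) (use c in auto)
    have "reds I (Par Q R) (HNu c (Par Q' R1))"
      by (rule wtrans_com[OF Q'(1)]) (auto intro: lts.lts_HComR com1(2) reds_HNu)
    then show ?thesis
      using observed_HNu[OF Q'(2)] X1 by blast
  next
    case (lts_FComL P0 h v P' R0 R')
    then have com: "lts I P (AFIn h v) P'" "lts I R (AFOut h v) R'" and X: "X = Par P' R'"
      by auto
    have noCur: "Cur \<notin> dom \<Gamma>"
      using separated_noCur[OF sep(1) com(1)] by blast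
    have R': "wt R' id \<Gamma>"
      using sr[OF com(2)] by simp
    obtain Q' where Q': "wtrans I \<Gamma> Q (AFIn h v) \<Gamma> Q'" "observed I (Par P' R') (Par Q' R')"
      by (rule match[OF ttrans_FIn[OF com(1) noCur] _ _ R']) auto
    have "reds I (Par Q R) (Par Q' R')"
      by (rule wtrans_com[OF Q'(1), where C = "\<lambda>X. X"]) (auto intro: lts.lts_FComL com(2))
    then show ?thesis
      using Q'(2) X by blast
  next
    case (lts_FComR P0 h v P' R0 R')
    then have com: "lts I P (AFOut h v) P'" "lts I R (AFIn h v) R'" and X: "X = Par P' R'"
      by auto
    have Cur: "Cur \<in> dom \<Gamma>" and R': "wt R' id \<Gamma>"
      using sr[OF com(2)] by simp_all
    obtain Q' where Q': "wtrans I \<Gamma> Q (AFOut h v) \<Gamma> Q'" "observed I (Par P' R') (Par Q' R')"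
      by (rule match[OF ttrans_FOut[OF com(1) Cur] _ _ R']) auto
    have "reds I (Par Q R) (Par Q' R')"
      by (rule wtrans_com[OF Q'(1), where C = "\<lambda>X. X"]) (auto intro: lts.lts_FComR com(2))
    then show ?thesis
      using Q'(2) X by blast
  qed auto
qed

lemma observed_red:
  "observed I X Y \<Longrightarrow> lts I X Tau X' \<Longrightarrow> \<exists>Y'. reds I Y Y' \<and> observed I X' Y'"
proof (induction arbitrary: X' rule: observed.induct)
  case (observed_Par \<Gamma> P Q R)
  then show ?case by (rule observed_Par_red)
next
  case (observed_HNu X Y a)
  obtain X'' where X'': "lts I X Tau X''" "X' = HNu a X''"
    using observed_HNu.prems by (rule lts_HNuE) simp
  then show ?case
    using observed_HNu.IH[OF X''(1)] reds_HNu observed.observed_HNu by blast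
qed

lemma weak_barb_HNu: "weak_barb I X w \<Longrightarrow> weak_barb I (HNu a X) w"
  unfolding weak_barb_def using reds_HNu lts_HNu[of I _ "ASucc w"] by fastforce

text \<open>A success of \<open>P\<close> is matched by typed bisimilarity, one of \<open>R\<close>
  is still available beside \<open>Q\<close>. Only the barb counts, so the residuals need not be
  related.\<close>

lemma observed_strong_barb:
  "observed I X Y \<Longrightarrow> lts I X (ASucc w) X' \<Longrightarrow> weak_barb I Y w"
proof (induction arbitrary: X' rule: observed.induct)
  case (observed_Par \<Gamma> P Q R)
  from observed_Par.prems show ?case
  proof (cases rule: lts.cases)
    case (lts_ParL P0 P' R0)
    then have "ttrans I \<Gamma> P (ASucc w) \<Gamma> P'"
      by (auto intro: ttrans_Succ)
    then obtain Q' where "wtrans I \<Gamma> Q (ASucc w) \<Gamma> Q'"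
      using typed_bisimilarity_step[OF observed_Par.hyps(1)] by fastforce
    then obtain Q1 Q2 where "ttaus I \<Gamma> Q Q1" "lts I Q1 (ASucc w) Q2"
      unfolding wtrans_def by (auto dest: ttrans_lts)
    moreover from this(2) have "lts I (Par Q1 R) (ASucc w) (Par Q2 R)"
      by (intro lts.lts_ParL) auto
    ultimately show ?thesis
      unfolding weak_barb_def using ttaus_reds_Par by blast
  next
    case (lts_ParR R0 R' P0)
    then have "lts I (Par Q R) (ASucc w) (Par Q R')"
      by (intro lts.lts_ParR) auto
    then show ?thesis
      unfolding weak_barb_def using reds_refl by blast
  qed auto
next
  case (observed_HNu X Y a)
  obtain X'' where "lts I X (ASucc w) X''"
    using observed_HNu.prems by (rule lts_HNuE) simp
  then show ?case
    using observed_HNu.IH weak_barb_HNu by blast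
qed

lemma observed_reds:
  assumes "reds I X X'" and "observed I X Y"
  shows "\<exists>Y'. reds I Y Y' \<and> observed I X' Y'"
  using assms unfolding reds_def
proof (induction rule: rtranclp_induct)
  case (step X' X'')
  then show ?case
    using observed_red reds_trans unfolding red_def reds_def by (metis reds_def)
qed blast

lemma observed_barbed_bisimilar:
  assumes "observed I X Y"
  shows "barbed_bisimilar I X Y"
proof -
  \<comment> \<open>The reductions before the barb are matched one by one, which reduces a weak barb
    to a strong one.\<close>
  have "weak_barb I Y w" if XY: "observed I X Y" and barb: "weak_barb I X w" for X Y w
  proof -
    obtain X' X'' where X': "reds I X X'" "lts I X' (ASucc w) X''"
      using barb unfolding weak_barb_def by blast
    obtain Y' where "reds I Y Y'" "observed I X' Y'"
      using observed_reds[OF X'(1) XY] by blast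
    then show ?thesis
      using observed_strong_barb[OF _ X'(2)] reds_trans unfolding weak_barb_def by blast
  qed
  then have "barbed_bisimulation I {(X, Y). observed I X Y}"
    unfolding barbed_bisimulation_def sym_def red_def
    using observed_sym observed_red by blast
  then show ?thesis
    using assms unfolding barbed_bisimilar_def by blast
qed

theorem mainTheorem9:
  fixes I :: "'f \<Rightarrow> 'v list \<Rightarrow> 'v"
    and \<Delta> \<Gamma> :: vis
    and P Q :: "('f, 'v) proc"
  assumes "visibility \<Delta>" and "visibility \<Gamma>"
    and "closed_proc P" and "closed_proc Q"
    and "typed \<Delta> P" and "typed \<Delta> Q"
    and "typed_bisimilar I \<Delta> \<Gamma> P Q"
  shows "barbed_equivalent I \<Gamma> P Q"
proof -
  have bis: "(\<Gamma>, P, Q) \<in> typed_bisimilarity I" and comp: "compatible \<Delta> \<Gamma>"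
    using assms(7) unfolding typed_bisimilar_def by auto
  \<comment> \<open>\<open>\<Delta>\<close> itself, with the identity environment, witnesses
    separation; compatibility keeps \<open>Cur\<close> on one side.\<close>
  have "separated \<Gamma> P" "separated \<Gamma> Q"
    using assms(1,5,6) comp typed_wt visibility_transitive
    unfolding separated_def compatible_def by blast+
  then show ?thesis
    unfolding barbed_equivalent_def
    using observed_Par[OF bis] typed_wt observed_barbed_bisimilar by blast
qed

end
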